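(* Consider the 2-body problem on the 3-sphere with a potential that is either strictly attractive ($f>0$ everywhere) or strictly repulsive ($f<0$ everywhere). All relative equilibria are completely classified, up to conjugacy (i.e. up to the action of $G_L\times G_R$), by the angle $\theta\in[0,\pi]$ subtended by the two particles as follows, where in each case the one-parameter subgroup of $G_L\times G_R$ may be supposed to be generated by $(|\xi|j,|\eta|j)\in\mathfrak g_L\times\mathfrak g_R$, so that the motion is $g_i(t)=e^{t|\xi|j}\,g_i\,e^{-t|\eta|j}$ with initial positions $g_i$. 1. (Singular) For $\theta=0$ one may take the initial positions $g_1=g_2=1$, and for $\theta=\pi$ one may take $g_1=-g_2=1$. Both $|\xi|$ and $|\eta|$ are arbitrary. 2. (Acute, $0<\theta<\pi/2$; obtuse, $\pi/2<\theta<\pi$) One may take the initial positions to be $g_1=e^{-i\phi_1}$ and $g_2=e^{i\phi_2}$, where the angles $\phi_1,\phi_2$ are determined by $\phi_1+\phi_2=\theta$ and $$m_1\sin2\phi_1=m_2\sin2\phi_2 .$$ 3. (Right-angled, $\theta=\pi/2$) These exist only for $m_1=m_2$. In this case one may again take $g_1=e^{-i\phi_1}$, $g_2=e^{i\phi_2}$, but $\phi_1,\phi_2$ are not uniquely determined by $m_1\sin2\phi_1=m_2\sin2\phi_2$: they may be any angles satisfying $\phi_1+\phi_2=\pi/2$ with $\phi_1\in(0,\pi/2)$ for a strictly attractive potential, or $\phi_1\in(-\pi/2,0)$ for a strictly repulsive potential. In all of the non-singular cases the angular velocities satisfy $$2|\xi||\eta|=\frac{f(\theta)\sin\theta}{\zeta},\qquad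 \zeta=m_1\sin2\phi_1=m_2\sin2\phi_2 .$$
   Context: $\mathbb H=\mathrm{Span}\{1,i,j,k\}$ is the algebra of real quaternions, identified with $\mathbb R^4$, with inner product $\langle p,q\rangle=\frac12(pq^\dagger+qp^\dagger)$ and norm $|p|^2=\langle p,p\rangle$. $G=S^3\subset\mathbb H$ is the group of unit quaternions, with Lie algebra $\mathfrak g=\mathrm{Im}\,\mathbb H$. The phase space of the 2-body problem on the 3-sphere is $$M=\{(g_1,p_1,g_2,p_2)\in\mathbb H^4: g_1,g_2\in G,\ \langle p_1,g_1\rangle=\langle p_2,g_2\rangle=0\}\cong T^*(G\times G),$$ with canonical symplectic form and Hamiltonian $H=\frac{|p_1|^2}{2m_1}+\frac{|p_2|^2}{2m_2}+V(g_1,g_2)$, $m_1,m_2>0$, where $V$ is a function of the distance $|g_2-g_1|$ only; dynamically $p_i=m_i\dot g_i$. The angle $\theta\in[0,\pi]$ subtended by the particles is given by $\cos\theta=\langle g_1,g_2\rangle$. Writing $V$ as a function of $r=\cos\theta$ via $V=V(1,e^{i\theta})$, the force is $f(\theta)=-dV/dr$. The potential is strictly attractive if $f>0$ everywhere and strictly repulsive if $f<0$ everywhere. (Collisions are disregarded; if $V$ is undefined at $\theta=0$ or $\theta=\pi$, the corresponding singular solutions do not arise.) The symmetry group $G_L\times G_R$ (two copies of $G$) acts on each of $g_1,p_1,g_2,p_2$ by $q\mapsto lqr^{-1}$ for $(l,r)\in G_L\times G_R$. A relative equilibrium is a solution in $M$ which is also the orbit of a one-parameter subgroup of $G_L\times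 G_R$. Since $(g_1,g_2)\mapsto(-g_1,-g_2)$ is a symmetry, one may also normalise $\phi_2\in[0,\pi]$. In the case of equal masses, the paper calls a relative equilibrium (for any $\theta$) isosceles if $\phi_1=\phi_2$. *)

theory Defs
  imports "HOL-Analysis.Analysis"
begin

section \<open>Quaternions\<close>

datatype quat = Quat (qre: real) (qim1: real) (qim2: real) (qim3: real)

lemma quat_eqI:
  "qre p = qre q \<Longrightarrow> qim1 p = qim1 q \<Longrightarrow> qim2 p = qim2 q \<Longrightarrow> qim3 p = qim3 q \<Longrightarrow> p = q"
  by (rule quat.expand) simp

lemma quat_eq_iff:
  "p = q \<longleftrightarrow> qre p = qre q \<and> qim1 p = qim1 q \<and> qim2 p = qim2 q \<and> qim3 p = qim3 q"
  by (auto intro: quat_eqI)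

definition qi :: quat where "qi = Quat 0 1 0 0"
definition qj :: quat where "qj = Quat 0 0 1 0"
definition qk :: quat where "qk = Quat 0 0 0 1"

definition qcnj :: "quat \<Rightarrow> quat" where
  "qcnj q = Quat (qre q) (- qim1 q) (- qim2 q) (- qim3 q)"

lemma qcnj_sel [simp]:
  "qre (qcnj q) = qre q" "qim1 (qcnj q) = - qim1 q"
  "qim2 (qcnj q) = - qim2 q" "qim3 (qcnj q) = - qim3 q"
  by (simp_all add: qcnj_def)

instantiation quat :: ab_group_add
begin
definition zero_quat :: quat where "0 = Quat 0 0 0 0"
definition plus_quat :: "quat \<Rightarrow> quat \<Rightarrow> quat" where
  "p + q = Quat (qre p + qre q) (qim1 p + qim1 q) (qim2 p + qim2 q) (qim3 p + qim3 q)"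
definition minus_quat :: "quat \<Rightarrow> quat \<Rightarrow> quat" where
  "p - q = Quat (qre p - qre q) (qim1 p - qim1 q) (qim2 p - qim2 q) (qim3 p - qim3 q)"
definition uminus_quat :: "quat \<Rightarrow> quat" where
  "- q = Quat (- qre q) (- qim1 q) (- qim2 q) (- qim3 q)"
instance
  by standard (simp_all add: zero_quat_def plus_quat_def minus_quat_def uminus_quat_def quat_eq_iff)
end

lemma quat_add_sel [simp]:
  "qre 0 = 0" "qim1 0 = 0" "qim2 0 = 0" "qim3 0 = 0"
  "qre (p + q) = qre p + qre q" "qim1 (p + q) = qim1 p + qim1 q"
  "qim2 (p + q) = qim2 p + qim2 q" "qim3 (p + q) = qim3 p + qim3 q"
  "qre (p - q) = qre p - qre q" "qim1 (p - q) = qim1 p - qim1 q"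
  "qim2 (p - q) = qim2 p - qim2 q" "qim3 (p - q) = qim3 p - qim3 q"
  "qre (- p) = - qre p" "qim1 (- p) = - qim1 p"
  "qim2 (- p) = - qim2 p" "qim3 (- p) = - qim3 p"
  by (simp_all add: zero_quat_def plus_quat_def minus_quat_def uminus_quat_def)

instantiation quat :: ring_1
begin
definition one_quat :: quat where "1 = Quat 1 0 0 0"
definition times_quat :: "quat \<Rightarrow> quat \<Rightarrow> quat" where
  "p * q = Quat
     (qre p * qre q - qim1 p * qim1 q - qim2 p * qim2 q - qim3 p * qim3 q)
     (qre p * qim1 q + qim1 p * qre q + qim2 p * qim3 q - qim3 p * qim2 q)
     (qre p * qim2 q - qim1 p * qim3 q + qim2 p * qre q + qim3 p * qim1 q)
     (qre p * qim3 q + qim1 p * qim2 q - qim2 p * qim1 q + qim3 p * qre q)"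
instance
  by standard (simp_all add: one_quat_def times_quat_def quat_eq_iff algebra_simps)
end

lemma quat_mult_sel [simp]:
  "qre 1 = 1" "qim1 1 = 0" "qim2 1 = 0" "qim3 1 = 0"
  "qre (p * q) = qre p * qre q - qim1 p * qim1 q - qim2 p * qim2 q - qim3 p * qim3 q"
  "qim1 (p * q) = qre p * qim1 q + qim1 p * qre q + qim2 p * qim3 q - qim3 p * qim2 q"
  "qim2 (p * q) = qre p * qim2 q - qim1 p * qim3 q + qim2 p * qre q + qim3 p * qim1 q"
  "qim3 (p * q) = qre p * qim3 q + qim1 p * qim2 q - qim2 p * qim1 q + qim3 p * qre q"
  by (simp_all add: one_quat_def times_quat_def)

lemma quat_unit_rules:
  "qi * qi = - 1" "qj * qj = - 1" "qk * qk = - 1"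
  "qi * qj = qk" "qj * qk = qi" "qk * qi = qj"
  by (simp_all add: qi_def qj_def qk_def quat_eq_iff)

instantiation quat :: real_algebra_1
begin
definition scaleR_quat :: "real \<Rightarrow> quat \<Rightarrow> quat" where
  "c *\<^sub>R q = Quat (c * qre q) (c * qim1 q) (c * qim2 q) (c * qim3 q)"
instance
  by standard (simp_all add: scaleR_quat_def quat_eq_iff algebra_simps)
end

lemma quat_scaleR_sel [simp]:
  "qre (c *\<^sub>R q) = c * qre q" "qim1 (c *\<^sub>R q) = c * qim1 q"
  "qim2 (c *\<^sub>R q) = c * qim2 q" "qim3 (c *\<^sub>R q) = c * qim3 q"
  by (simp_all add: scaleR_quat_def)

lemma euler_four_square:
  "((a::real)*x - b*y - c*z - d*w)\<^sup>2 + (a*y + b*x + c*w - d*z)\<^sup>2 +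
   (a*z - b*w + c*x + d*y)\<^sup>2 + (a*w + b*z - c*y + d*x)\<^sup>2 =
   (a\<^sup>2 + b\<^sup>2 + c\<^sup>2 + d\<^sup>2) * (x\<^sup>2 + y\<^sup>2 + z\<^sup>2 + w\<^sup>2)"
  by algebra

instantiation quat :: real_normed_div_algebra
begin
definition norm_quat :: "quat \<Rightarrow> real" where
  "norm q = sqrt ((qre q)\<^sup>2 + (qim1 q)\<^sup>2 + (qim2 q)\<^sup>2 + (qim3 q)\<^sup>2)"
definition sgn_quat :: "quat \<Rightarrow> quat" where "sgn (q :: quat) = q /\<^sub>R norm q"
definition dist_quat :: "quat \<Rightarrow> quat \<Rightarrow> real" where "dist (p :: quat) q = norm (p - q)"
definition uniformity_quat :: "(quat \<times> quat) filter" where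
  "uniformity_quat = (INF e\<in>{0<..}. principal {(x :: quat, y). dist x y < e})"
definition open_quat :: "quat set \<Rightarrow> bool" where
  "open_quat U \<longleftrightarrow> (\<forall>x\<in>U. eventually (\<lambda>(x', y). x' = x \<longrightarrow> y \<in> U) uniformity)"
definition inverse_quat :: "quat \<Rightarrow> quat" where
  "inverse (q :: quat) = qcnj q /\<^sub>R (norm q)\<^sup>2"
definition divide_quat :: "quat \<Rightarrow> quat \<Rightarrow> quat" where
  "divide_quat p q = p * inverse q"
instance
proof
  fix p q :: quat and c :: real
  let ?C = "\<lambda>q. (Complex (qre q) (qim1 q), Complex (qim2 q) (qim3 q))"
  have C: "norm q = norm (?C q)" for q
    by (simp add: norm_quat_def norm_Pair complex_norm add.assoc)
  have add: "?C (p + q) = ?C p + ?C q" by (simp add: complex_eq_iff)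
  show "norm (p + q) \<le> norm p + norm q"
    unfolding C add by (rule norm_triangle_ineq)
  show "norm q = 0 \<longleftrightarrow> q = 0"
    unfolding C by (auto simp: quat_eq_iff complex_eq_iff zero_prod_def)
  have scaleR: "?C (c *\<^sub>R q) = c *\<^sub>R ?C q" by (simp add: complex_eq_iff)
  show "norm (c *\<^sub>R q) = \<bar>c\<bar> * norm q"
    unfolding C scaleR by (rule norm_scaleR)
  show "norm (p * q) = norm p * norm q"
    unfolding norm_quat_def real_sqrt_mult [symmetric] quat_mult_sel
    by (rule arg_cong [where f = sqrt]) (rule euler_four_square)
  have sq: "(norm q)\<^sup>2 = (qre q)\<^sup>2 + (qim1 q)\<^sup>2 + (qim2 q)\<^sup>2 + (qim3 q)\<^sup>2"
    by (simp add: norm_quat_def)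
  have mult: "q * qcnj q = (norm q)\<^sup>2 *\<^sub>R 1" "qcnj q * q = (norm q)\<^sup>2 *\<^sub>R 1"
    unfolding sq by (simp_all add: quat_eq_iff power2_eq_square)
  assume "q \<noteq> 0"
  then have "(norm q)\<^sup>2 \<noteq> 0"
    unfolding C by (auto simp: quat_eq_iff complex_eq_iff zero_prod_def)
  with mult show "inverse q * q = 1" "q * inverse q = 1"
    by (simp_all add: inverse_quat_def)
next
  show "inverse (0 :: quat) = 0"
    by (simp add: inverse_quat_def quat_eq_iff)
qed (simp_all add: sgn_quat_def dist_quat_def uniformity_quat_def open_quat_def divide_quat_def)
end

instantiation quat :: real_inner
begin
definition inner_quat :: "quat \<Rightarrow> quat \<Rightarrow> real" where
  "p \<bullet> q = qre p * qre q + qim1 p * qim1 q + qim2 p * qim2 q + qim3 p * qim3 q"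
instance
proof
  fix p :: quat
  have n: "norm p = sqrt (p \<bullet> p)"
    by (simp add: norm_quat_def inner_quat_def power2_eq_square)
  show "norm p = sqrt (p \<bullet> p)" by (rule n)
  show "0 \<le> p \<bullet> p" by (simp add: inner_quat_def)
  show "p \<bullet> p = 0 \<longleftrightarrow> p = 0"
    using n norm_eq_zero [of p] by simp
qed (simp_all add: inner_quat_def algebra_simps)
end

lemma inner_quat_eq_qcnj: "of_real (p \<bullet> q) = (1/2) *\<^sub>R (p * qcnj q + q * qcnj p)"
  by (simp add: quat_eq_iff inner_quat_def of_real_def)

instantiation quat :: euclidean_space
begin
definition Basis_quat :: "quat set" where "Basis = {1, qi, qj, qk}"
instance
proof
  fix u v x :: quat
  show "(Basis :: quat set) \<noteq> {}" "finite (Basis :: quat set)"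
    by (simp_all add: Basis_quat_def)
  show "u \<in> Basis \<Longrightarrow> v \<in> Basis \<Longrightarrow> u \<bullet> v = (if u = v then 1 else 0)"
    unfolding Basis_quat_def
    by (elim insertE emptyE; simp add: inner_quat_def qi_def qj_def qk_def quat_eq_iff)
  show "(\<forall>u\<in>Basis. x \<bullet> u = 0) \<longleftrightarrow> x = 0"
    unfolding Basis_quat_def ball_simps
    by (simp add: inner_quat_def qi_def qj_def qk_def quat_eq_iff)
qed
end

abbreviation S3 :: "quat set" where "S3 \<equiv> sphere 0 1"

abbreviation ImH :: "quat set" where "ImH \<equiv> {q. qre q = 0}"

section \<open>The two-body problem on the 3-sphere\<close>

text \<open>Phase points are ordered as \<open>(g\<^sub>1, p\<^sub>1, g\<^sub>2, p\<^sub>2)\<close>.\<close>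

type_synonym phase = "quat \<times> quat \<times> quat \<times> quat"

definition subtended_angle :: "quat \<Rightarrow> quat \<Rightarrow> real" where
  "subtended_angle g1 g2 = arccos (g1 \<bullet> g2)"

definition phase_angle :: "phase \<Rightarrow> real" where
  "phase_angle = (\<lambda>(g1, p1, g2, p2). subtended_angle g1 g2)"

text \<open>\<open>\<Theta>\<close> is the set of angles at which the potential is defined: it contains the open
  interval from \<open>0\<close> to \<open>pi\<close>, and possibly one or both of the endpoints.\<close>

definition phase_space :: "real set \<Rightarrow> phase set" where
  "phase_space \<Theta> = {(g1, p1, g2, p2).
     g1 \<in> S3 \<and> g2 \<in> S3 \<and> p1 \<bullet> g1 = 0 \<and> p2 \<bullet> g2 = 0 \<and> subtended_angle g1 g2 \<in> \<Theta>}"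

text \<open>The canonical form \<open>\<Sum> dg\<^sub>i \<and> dp\<^sub>i\<close>, to be restricted to the phase space.\<close>

definition symplectic_form :: "phase \<Rightarrow> phase \<Rightarrow> real" where
  "symplectic_form = (\<lambda>(dg1, dp1, dg2, dp2) (dg1', dp1', dg2', dp2').
     dg1 \<bullet> dp1' - dp1 \<bullet> dg1' + dg2 \<bullet> dp2' - dp2 \<bullet> dg2')"

definition hamiltonian :: "real \<Rightarrow> real \<Rightarrow> (quat \<Rightarrow> quat \<Rightarrow> real) \<Rightarrow> phase \<Rightarrow> real" where
  "hamiltonian m1 m2 V = (\<lambda>(g1, p1, g2, p2).
     (norm p1)\<^sup>2 / (2 * m1) + (norm p2)\<^sup>2 / (2 * m2) + V g1 g2)"

text \<open>Hamilton's equation \<open>\<omega>(x', v) = dH(v)\<close> for every tangent vector \<open>v\<close> of \<open>M\<close> at \<open>x t\<close>.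
  Tangent vectors are velocities of curves \<open>c\<close> in \<open>M\<close>, and \<open>dH(v)\<close> is the derivative of \<open>H\<close>
  along \<open>c\<close>; no extension of \<open>H\<close> off \<open>M\<close> enters.\<close>

definition hamiltonian_solution ::
  "phase set \<Rightarrow> (phase \<Rightarrow> real) \<Rightarrow> (real \<Rightarrow> phase) \<Rightarrow> bool" where
  "hamiltonian_solution M H x \<longleftrightarrow> (\<forall>t. x t \<in> M \<and>
     (\<exists>x'. (x has_vector_derivative x') (at t) \<and>
        (\<forall>c v. (\<forall>s. c s \<in> M) \<and> c 0 = x t \<and> (c has_vector_derivative v) (at 0) \<longrightarrow>
           ((\<lambda>s. H (c s)) has_real_derivative symplectic_form x' v) (at (0::real)))))"

definition act :: "quat \<Rightarrow> quat \<Rightarrow> phase \<Rightarrow> phase" where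
  "act l r = (\<lambda>(g1, p1, g2, p2).
     (l * g1 * inverse r, l * p1 * inverse r, l * g2 * inverse r, l * p2 * inverse r))"

definition conjugate :: "(real \<Rightarrow> phase) \<Rightarrow> (real \<Rightarrow> phase) \<Rightarrow> bool" where
  "conjugate x y \<longleftrightarrow> (\<exists>l\<in>S3. \<exists>r\<in>S3. \<forall>t. y t = act l r (x t))"

text \<open>\<open>x\<close> is a relative equilibrium whose one-parameter subgroup is generated by
  \<open>(\<xi>, \<eta>)\<close>.\<close>

definition relative_equilibrium ::
  "real set \<Rightarrow> real \<Rightarrow> real \<Rightarrow> (quat \<Rightarrow> quat \<Rightarrow> real) \<Rightarrow> quat \<Rightarrow> quat \<Rightarrow> (real \<Rightarrow> phase) \<Rightarrow> bool" where
  "relative_equilibrium \<Theta> m1 m2 V \<xi> \<eta> x \<longleftrightarrow>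
     \<xi> \<in> ImH \<and> \<eta> \<in> ImH \<and>
     hamiltonian_solution (phase_space \<Theta>) (hamiltonian m1 m2 V) x \<and>
     (\<forall>t. x t = act (exp (t *\<^sub>R \<xi>)) (exp (t *\<^sub>R \<eta>)) (x 0))"

text \<open>The motion \<open>g\<^sub>i(t) = e\<^bsup>taj\<^esup> g\<^sub>i e\<^bsup>-tbj\<^esup>\<close>, lifted to phase space by \<open>p\<^sub>i = m\<^sub>i g\<^sub>i'\<close>.\<close>

definition j_motion :: "real \<Rightarrow> real \<Rightarrow> quat \<Rightarrow> real \<Rightarrow> quat" where
  "j_motion a b g t = exp ((t * a) *\<^sub>R qj) * g * exp (- ((t * b) *\<^sub>R qj))"

definition standard_motion ::
  "real \<Rightarrow> real \<Rightarrow> real \<Rightarrow> real \<Rightarrow> quat \<Rightarrow> quat \<Rightarrow> real \<Rightarrow> phase" where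
  "standard_motion m1 m2 a b g1 g2 t =
     (j_motion a b g1 t, m1 *\<^sub>R vector_derivative (j_motion a b g1) (at t),
      j_motion a b g2 t, m2 *\<^sub>R vector_derivative (j_motion a b g2) (at t))"

abbreviation expi :: "real \<Rightarrow> quat" where "expi \<phi> \<equiv> exp (\<phi> *\<^sub>R qi)"

text \<open>The potential depends on the distance only, and \<open>f(\<theta>) = - dV/dr\<close> with
  \<open>r = cos \<theta>\<close> and \<open>V = V(1, e\<^bsup>i\<theta>\<^esup>)\<close>; at an endpoint of the interval of angles
  belonging to \<open>\<Theta>\<close> the derivative is one-sided.\<close>

definition distance_potential :: "real set \<Rightarrow> (quat \<Rightarrow> quat \<Rightarrow> real) \<Rightarrow> bool" where
  "distance_potential \<Theta> V \<longleftrightarrow> (\<forall>g1\<in>S3. \<forall>g2\<in>S3. \<forall>h1\<in>S3. \<forall>h2\<in>S3.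
     subtended_angle g1 g2 \<in> \<Theta> \<and> norm (g2 - g1) = norm (h2 - h1) \<longrightarrow> V g1 g2 = V h1 h2)"

definition has_force :: "real set \<Rightarrow> (quat \<Rightarrow> quat \<Rightarrow> real) \<Rightarrow> (real \<Rightarrow> real) \<Rightarrow> bool" where
  "has_force \<Theta> V f \<longleftrightarrow> (\<forall>\<theta>\<in>\<Theta>.
     ((\<lambda>r. V 1 (expi (arccos r))) has_real_derivative - f \<theta>) (at (cos \<theta>) within cos ` \<Theta>))"

definition strictly_attractive :: "real set \<Rightarrow> (real \<Rightarrow> real) \<Rightarrow> bool" where
  "strictly_attractive \<Theta> f \<longleftrightarrow> (\<forall>\<theta>\<in>\<Theta>. 0 < f \<theta>)"

definition strictly_repulsive :: "real set \<Rightarrow> (real \<Rightarrow> real) \<Rightarrow> bool" where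
  "strictly_repulsive \<Theta> f \<longleftrightarrow> (\<forall>\<theta>\<in>\<Theta>. f \<theta> < 0)"

definition right_angle_range :: "real set \<Rightarrow> (real \<Rightarrow> real) \<Rightarrow> real \<Rightarrow> bool" where
  "right_angle_range \<Theta> f \<phi>1 \<longleftrightarrow>
     (strictly_attractive \<Theta> f \<longrightarrow> 0 < \<phi>1 \<and> \<phi>1 < pi / 2) \<and>
     (strictly_repulsive \<Theta> f \<longrightarrow> - pi / 2 < \<phi>1 \<and> \<phi>1 < 0)"

text \<open>\<open>2|\<xi>||\<eta>| = f(\<theta>) sin \<theta> / \<zeta>\<close> with \<open>\<zeta> = m\<^sub>1 sin 2\<phi>\<^sub>1 = m\<^sub>2 sin 2\<phi>\<^sub>2\<close>,
  where \<open>a = |\<xi>|\<close> and \<open>b = |\<eta>|\<close>.\<close>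

definition velocity_relation ::
  "real \<Rightarrow> real \<Rightarrow> (real \<Rightarrow> real) \<Rightarrow> real \<Rightarrow> real \<Rightarrow> real \<Rightarrow> real \<Rightarrow> real \<Rightarrow> bool" where
  "velocity_relation m1 m2 f \<theta> \<phi>1 \<phi>2 a b \<longleftrightarrow>
     (\<exists>\<zeta>. \<zeta> \<noteq> 0 \<and> \<zeta> = m1 * sin (2 * \<phi>1) \<and> \<zeta> = m2 * sin (2 * \<phi>2) \<and>
        2 * a * b = f \<theta> * sin \<theta> / \<zeta>)"

end

theory Submission
  imports Defs
begin

text \<open>Writing \<open>p\<^sub>i = m\<^sub>i g\<^sub>i'\<close>, Hamilton's equations say that \<open>m\<^sub>i g\<^sub>i''\<close> is \<open>f(\<theta>)\<close> times the other
  particle's position, up to a multiple of \<open>g\<^sub>i\<close>. Along \<open>g\<^sub>i(t) = e\<^bsup>t\<xi>\<^esup> g\<^sub>i e\<^bsup>-t\<eta>\<^esup>\<close> the acceleration is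
  \<open>- (|\<xi>|\<^sup>2 + |\<eta>|\<^sup>2) g\<^sub>i - 2 \<xi> g\<^sub>i \<eta>\<close>, so a relative equilibrium is a pair with
  \<open>- 2 m\<^sub>1 \<xi> g\<^sub>1 \<eta> = f g\<^sub>2 + \<mu>\<^sub>1 g\<^sub>1\<close> and \<open>- 2 m\<^sub>2 \<xi> g\<^sub>2 \<eta> = f g\<^sub>1 + \<mu>\<^sub>2 g\<^sub>2\<close>. Away from \<open>\<theta> = 0, \<pi>\<close> the plane of
  \<open>g\<^sub>1, g\<^sub>2\<close> is therefore invariant under the map \<open>q \<mapsto> \<xi> q \<eta>\<close>, which is a multiple of an orthogonal
  involution and acts on the plane with both eigenvalues. Moving the two eigenvectors to \<open>1\<close> and
  \<open>i\<close> turns \<open>\<xi>\<close> and \<open>\<eta>\<close> into multiples of \<open>j\<close>, and the balance equations become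
  \<open>2 |\<xi>| |\<eta>| m\<^sub>i sin 2\<phi>\<^sub>i = f(\<theta>) sin \<theta>\<close>. If
  \<open>g\<^sub>2 = \<plusminus> g\<^sub>1\<close>, the equations make \<open>\<xi>\<close> and \<open>g\<^sub>1 \<eta> g\<^sub>1\<^sup>-\<^sup>1\<close> parallel, so the motion follows a great circle.\<close>

section \<open>Quaternion algebra\<close>

lemma quat_im_square: "u * u = - ((norm u)\<^sup>2 *\<^sub>R 1)" if "u \<in> ImH" for u :: quat
  using that by (auto simp: quat_eq_iff norm_quat_def power2_eq_square)

lemma quat_mult_qcnj: "q * qcnj q = (norm q)\<^sup>2 *\<^sub>R 1" "qcnj q * q = (norm q)\<^sup>2 *\<^sub>R 1"
  by (simp_all add: quat_eq_iff norm_quat_def power2_eq_square)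

lemma qcnj_mult: "qcnj (p * q) = qcnj q * qcnj p"
  by (simp add: quat_eq_iff algebra_simps)

lemma norm_qcnj [simp]: "norm (qcnj q) = norm q"
  by (simp add: norm_quat_def)

lemma inverse_S3: "inverse q = qcnj q" if "q \<in> S3"
  using that by (simp add: inverse_quat_def)

text \<open>The norm is multiplicative, so multiplying by unit quaternions on both sides is a linear
  isometry; polarization carries this over to inner products.\<close>

lemma inner_S3_mult: "(l * p * r) \<bullet> (l * q * r) = p \<bullet> q"
  if "l \<in> S3" "r \<in> S3" for l p q r :: quat
proof -
  have "norm (l * x * r) = norm x" for x
    using that by (simp add: norm_mult)
  moreover have "l * p * r + l * q * r = l * (p + q) * r"
    by (simp add: algebra_simps)
  ultimately show ?thesis
    unfolding dot_norm by simp
qed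

lemma inner_mult_im: "q \<bullet> (u * q) = 0" "q \<bullet> (q * u) = 0" if "u \<in> ImH" for u q :: quat
  using that by (auto simp: inner_quat_def algebra_simps)

lemma norm_qunits [simp]: "norm qi = 1" "norm qj = 1" "norm qk = 1"
  by (simp_all add: norm_quat_def qi_def qj_def qk_def)

lemma qunits_sel [simp]:
  "qre qi = 0" "qim1 qi = 1" "qim2 qi = 0" "qim3 qi = 0"
  "qre qj = 0" "qim1 qj = 0" "qim2 qj = 1" "qim3 qj = 0"
  "qre qk = 0" "qim1 qk = 0" "qim2 qk = 0" "qim3 qk = 1"
  by (simp_all add: qi_def qj_def qk_def)

lemma qunits_nonzero [simp]: "qi \<noteq> 0" "qj \<noteq> 0" "qk \<noteq> 0"
  by (simp_all add: quat_eq_iff)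

text \<open>The product of \<open>exp (- t u)\<close> with the right-hand side has derivative zero
  because \<open>u * u = - 1\<close>, so it keeps its value 1 at time 0.\<close>

lemma exp_scaleR_square_minus_one:
  fixes u :: quat
  assumes "u * u = - 1"
  shows "exp (t *\<^sub>R u) = cos t *\<^sub>R 1 + sin t *\<^sub>R u"
proof -
  define h where "h t = exp (t *\<^sub>R (- u)) * (cos t *\<^sub>R 1 + sin t *\<^sub>R u)" for t
  have "(h has_vector_derivative 0) (at t)" for t
  proof -
    have "((\<lambda>t. cos t *\<^sub>R 1 + sin t *\<^sub>R u) has_vector_derivative
        - sin t *\<^sub>R 1 + cos t *\<^sub>R u) (at t)"
      by (auto intro!: derivative_eq_intros)
    from has_vector_derivative_mult [OF exp_scaleR_has_vector_derivative_right this, of "- u"]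
    show ?thesis
      unfolding h_def using assms by (simp add: algebra_simps mult.assoc)
  qed
  then obtain c where "\<And>t. h t = c"
    using has_vector_derivative_zero_constant [of UNIV h] by auto
  then have "h t = h 0" by simp
  then have 1: "exp (- (t *\<^sub>R u)) * (cos t *\<^sub>R 1 + sin t *\<^sub>R u) = 1"
    by (simp add: h_def)
  have "exp (t *\<^sub>R u) * (exp (- (t *\<^sub>R u)) * (cos t *\<^sub>R 1 + sin t *\<^sub>R u)) =
      cos t *\<^sub>R 1 + sin t *\<^sub>R u"
    unfolding mult.assoc [symmetric] exp_minus_inverse by simp
  then show ?thesis
    unfolding 1 by simp
qed

lemma exp_im: "exp (t *\<^sub>R u) = cos (t * norm u) *\<^sub>R 1 + sin (t * norm u) *\<^sub>R sgn u"
  if "u \<in> ImH" for u :: quat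
proof (cases "u = 0")
  case False
  moreover from that have "sgn u \<in> ImH"
    by (simp add: sgn_div_norm)
  ultimately have "sgn u * sgn u = - 1"
    using quat_im_square [of "sgn u"] by (simp add: norm_sgn)
  from exp_scaleR_square_minus_one [OF this, of "t * norm u"] False show ?thesis
    by (simp add: sgn_div_norm mult.assoc)
qed simp

lemma exp_im_S3: "exp u \<in> S3" if "u \<in> ImH"
proof (cases "u = 0")
  case False
  with exp_im [OF that, of 1] that have "(norm (exp u))\<^sup>2 = (cos (norm u))\<^sup>2 + (sin (norm u))\<^sup>2 * (norm (sgn u))\<^sup>2"
    by (simp add: sgn_div_norm norm_quat_def power_mult_distrib distrib_left)
  with False show ?thesis by (simp add: norm_sgn power2_eq_imp_eq [of _ 1])
qed simp

lemma exp_quat_sel [simp]: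
  "qre (exp (t *\<^sub>R qi)) = cos t" "qim1 (exp (t *\<^sub>R qi)) = sin t"
  "qim2 (exp (t *\<^sub>R qi)) = 0" "qim3 (exp (t *\<^sub>R qi)) = 0"
  "qre (exp (- (t *\<^sub>R qi))) = cos t" "qim1 (exp (- (t *\<^sub>R qi))) = - sin t"
  "qim2 (exp (- (t *\<^sub>R qi))) = 0" "qim3 (exp (- (t *\<^sub>R qi))) = 0"
  using exp_scaleR_square_minus_one [OF quat_unit_rules(1), of "- t"]
  by (simp_all add: exp_scaleR_square_minus_one quat_unit_rules)

lemma exp_uminus_eq_inverse: "exp (- x) = inverse (exp x)"
  for x :: "'a :: {real_normed_div_algebra, banach}"
  by (rule inverse_unique [symmetric]) (rule exp_minus_inverse)

text \<open>Conjugation is multiplicative on powers and bounded linear, so it passes through the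
  exponential series term by term.\<close>

lemma exp_conjugate: "exp (l * u * inverse l) = l * exp u * inverse l"
  if "l \<noteq> 0" for l u :: "'a :: {real_normed_div_algebra, banach}"
proof -
  have pow: "(l * u * inverse l) ^ n = l * u ^ n * inverse l" for n
  proof (induction n)
    case (Suc n)
    have "(l * u * inverse l) ^ Suc n = l * u * (inverse l * l) * u ^ n * inverse l"
      unfolding power_Suc Suc by (simp only: mult.assoc)
    with that show ?case by (simp only: left_inverse mult_1_right power_Suc mult.assoc not_False_eq_True)
  qed (use that in simp)
  have "bounded_linear (\<lambda>x. l * x * inverse l)"
    by (intro bounded_linear_intros)
  from bounded_linear.suminf [OF this summable_exp_generic [of u]]
  show ?thesis
    by (simp add: exp_def pow)
qed

text \<open>Both sides are \<open>u + v\<close>. The intertwiner \<open>1 - v * u\<close> vanishes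
  exactly when \<open>u = - v\<close>, which is the exceptional case in the two rotation lemmas
  below.\<close>

lemma quat_intertwine:
  fixes u v :: quat
  assumes "u * u = - 1" "v * v = - 1"
  shows "v * (1 - v * u) = (1 - v * u) * u"
proof -
  have "v * (v * u) = - u" "v * u * u = - v"
    using assms by (simp_all add: mult.assoc [symmetric]) (simp add: mult.assoc)
  then show ?thesis by (simp add: algebra_simps)
qed

lemma S3_intertwine_normalize:
  fixes q u v :: quat
  assumes "v * q = q * u" "q \<noteq> 0"
  shows "sgn q \<in> S3" "v * sgn q = sgn q * u"
  using assms by (simp_all add: norm_sgn sgn_div_norm)

text \<open>The normalized intertwiner \<open>1 - qj * u\<close> works unless
  \<open>u = - qj\<close>; there \<open>qi\<close> works because it anticommutes with
  \<open>qj\<close>.\<close>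

lemma exists_rotation_to_j:
  assumes "u * u = - 1"
  shows "\<exists>l\<in>S3. l * u = qj * l"
proof (cases "u = - qj")
  case True
  then show ?thesis
    by (intro bexI [of _ qi]) (simp_all add: quat_eq_iff)
next
  case False
  have "1 - qj * u \<noteq> 0"
  proof
    assume "1 - qj * u = 0"
    then have "qj * (qj * u) = qj" by simp
    then have "- u = qj" by (simp add: mult.assoc [symmetric] quat_unit_rules)
    with False show False by (metis minus_minus)
  qed
  from S3_intertwine_normalize [OF quat_intertwine [OF assms quat_unit_rules(2)] this]
  show ?thesis by metis
qed

text \<open>First \<open>v\<close> is rotated to \<open>qj\<close>. The image \<open>w\<close> of
  \<open>u\<close> anticommutes with \<open>qj\<close>, so the second intertwiner
  \<open>1 - qi * w\<close> commutes with \<open>qj\<close> and does not spoil the first step. In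
  the exceptional case \<open>w = - qi\<close>, \<open>qj\<close> is the second rotation.\<close>

lemma exists_rotation_to_ij:
  assumes u: "u * u = - 1" and v: "v * v = - 1" and anti: "v * u = - (u * v)"
  shows "\<exists>l\<in>S3. l * u = qi * l \<and> l * v = qj * l"
proof -
  obtain l where l: "l \<in> S3" and lv: "l * v = qj * l"
    using exists_rotation_to_j [OF v] by blast
  then have l0: "l \<noteq> 0" by auto
  define w where "w = l * u * inverse l"
  have wl: "w * l = l * u" using l0 by (simp add: w_def mult.assoc)
  have "w * w = l * u * (inverse l * l) * u * inverse l"
    by (simp add: w_def mult.assoc)
  also have "\<dots> = l * (u * u) * inverse l" using l0 by (simp add: mult.assoc)
  finally have w: "w * w = - 1" using u l0 by simp
  have "qj * w * l = l * (v * u)" 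
    by (simp add: mult.assoc wl) (simp add: mult.assoc [symmetric] lv)
  also have "\<dots> = - (w * qj * l)"
    by (simp add: anti mult.assoc lv [symmetric]) (simp add: mult.assoc [symmetric] wl)
  finally have "(qj * w + w * qj) * l = 0" by (simp add: algebra_simps)
  with l0 have jw: "qj * w = - (w * qj)" by (simp add: eq_neg_iff_add_eq_0)
  show ?thesis
  proof (cases "w = - qi")
    case True
    have "qj * l * u = qi * (qj * l)" "qj * l * v = qj * (qj * l)"
      using wl lv by (simp_all add: mult.assoc True flip: wl)
        (simp add: mult.assoc [symmetric] quat_eq_iff)
    with l show ?thesis by (intro bexI [of _ "qj * l"]) (simp_all add: norm_mult)
  next
    case False
    have "1 - qi * w \<noteq> 0"
    proof
      assume "1 - qi * w = 0"
      then have "qi * (qi * w) = qi" by simp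
      then have "- w = qi" by (simp add: mult.assoc [symmetric] quat_unit_rules)
      with False show False by (metis minus_minus)
    qed
    note S3_intertwine_normalize [OF quat_intertwine [OF w quat_unit_rules(1)] this]
    moreover have "qj * (1 - qi * w) = (1 - qi * w) * qj"
    proof -
      have "qj * (qi * w) = - (qi * (qj * w))"
        by (simp add: mult.assoc [symmetric]) (simp add: quat_eq_iff)
      then show ?thesis by (simp add: algebra_simps jw)
    qed
    note S3_intertwine_normalize [OF this \<open>1 - qi * w \<noteq> 0\<close>]
    ultimately obtain m where m: "m \<in> S3" "qi * m = m * w" "qj * m = m * qj"
      by blast
    have "m * l * u = qi * (m * l)" "m * l * v = qj * (m * l)"
      by (simp_all add: mult.assoc flip: wl) (simp_all add: lv mult.assoc [symmetric] m)
    with l m show ?thesis by (intro bexI [of _ "m * l"]) (simp_all add: norm_mult)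
  qed
qed

section \<open>Hamilton's equations\<close>

lemma has_real_derivative_inner:
  fixes p q :: "real \<Rightarrow> 'a :: real_inner"
  assumes "(p has_vector_derivative p') (at t)" "(q has_vector_derivative q') (at t)"
  shows "((\<lambda>t. p t \<bullet> q t) has_real_derivative p t \<bullet> q' + p' \<bullet> q t) (at t)"
  using bounded_bilinear.has_vector_derivative [OF bounded_bilinear_inner assms]
  by (simp add: has_real_derivative_iff_has_vector_derivative)

lemma inner_constant_imp_derivative_eq_0:
  fixes p q :: "real \<Rightarrow> 'a :: real_inner"
  assumes "(p has_vector_derivative p') (at t)" "(q has_vector_derivative q') (at t)"
    and "\<And>t. p t \<bullet> q t = c"
  shows "p t \<bullet> q' + p' \<bullet> q t = 0"
  using DERIV_unique [OF has_real_derivative_inner [OF assms(1,2)]] assms(3) by simp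

lemma has_vector_derivative_phase:
  fixes x :: "real \<Rightarrow> phase"
  assumes "(x has_vector_derivative (g1', p1', g2', p2')) F"
  shows "((\<lambda>t. fst (x t)) has_vector_derivative g1') F"
    "((\<lambda>t. fst (snd (x t))) has_vector_derivative p1') F"
    "((\<lambda>t. fst (snd (snd (x t)))) has_vector_derivative g2') F"
    "((\<lambda>t. snd (snd (snd (x t)))) has_vector_derivative p2') F"
proof -
  note fst = bounded_linear.has_vector_derivative [OF bounded_linear_fst]
  note snd = bounded_linear.has_vector_derivative [OF bounded_linear_snd]
  show "((\<lambda>t. fst (x t)) has_vector_derivative g1') F"
    using fst [OF assms] by simp
  note x2 = snd [OF assms, simplified]
  show "((\<lambda>t. fst (snd (x t))) has_vector_derivative p1') F"
    using fst [OF x2] by simp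
  note x3 = snd [OF x2, simplified]
  show "((\<lambda>t. fst (snd (snd (x t)))) has_vector_derivative g2') F"
    using fst [OF x3] by simp
  show "((\<lambda>t. snd (snd (snd (x t)))) has_vector_derivative p2') F"
    using snd [OF x3] by simp
qed

section \<open>Inner products and subtended angles on the 3-sphere\<close>

lemma S3_inner_self: "g \<bullet> g = 1" if "g \<in> S3"
  using that by (simp add: dot_square_norm)

lemma S3_inner_bounds: "- 1 \<le> g \<bullet> h" "g \<bullet> h \<le> 1" if "g \<in> S3" "h \<in> S3"
  using Cauchy_Schwarz_ineq2 [of g h] that by auto

lemma subtended_angle_bounds:
  "0 \<le> subtended_angle g h" "subtended_angle g h \<le> pi" if "g \<in> S3" "h \<in> S3"
  unfolding subtended_angle_def using S3_inner_bounds [OF that] by (simp_all add: arccos_lbound arccos_ubound)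

lemma cos_subtended_angle: "cos (subtended_angle g h) = g \<bullet> h" if "g \<in> S3" "h \<in> S3"
  unfolding subtended_angle_def using S3_inner_bounds [OF that] by simp

lemma norm_diff_S3: "norm (h - g) = sqrt (2 - 2 * (g \<bullet> h))" if "g \<in> S3" "h \<in> S3"
proof -
  have "(norm (h - g))\<^sup>2 = 2 - 2 * (g \<bullet> h)"
    unfolding power2_norm_eq_inner using S3_inner_self [OF that(1)] S3_inner_self [OF that(2)]
    by (simp add: inner_diff inner_commute algebra_simps)
  then show ?thesis
    by (metis norm_ge_zero real_sqrt_unique)
qed

lemma norm_expi [simp]: "norm (exp (t *\<^sub>R qi)) = 1" "norm (exp (- (t *\<^sub>R qi))) = 1"
  using exp_im_S3 [of "t *\<^sub>R qi"] exp_im_S3 [of "- (t *\<^sub>R qi)"] by simp_all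

section \<open>Derivatives of the potential and the Hamiltonian along curves in phase space\<close>

locale two_body =
  fixes m1 m2 :: real
    and \<Theta> :: "real set"
    and V :: "quat \<Rightarrow> quat \<Rightarrow> real"
    and f :: "real \<Rightarrow> real"
  assumes masses: "0 < m1" "0 < m2"
    and angles: "{0<..<pi} \<subseteq> \<Theta>" "\<Theta> \<subseteq> {0..pi}"
    and potential: "distance_potential \<Theta> V" "has_force \<Theta> V f"
begin

text \<open>The distance is a function of the inner product \<open>r\<close>, so the potential along
  the curve is \<open>W\<close> composed with \<open>r\<close>. At an endpoint of the angle range
  \<open>W\<close> has only a one-sided derivative, so the chain rule is applied within the range of
  \<open>r\<close>.\<close>

lemma potential_derivative:
  assumes S3: "\<And>s. c1 s \<in> S3" "\<And>s. c2 s \<in> S3"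
    and \<Theta>: "\<And>s. subtended_angle (c1 s) (c2 s) \<in> \<Theta>"
    and w1: "(c1 has_vector_derivative w1) (at t)" and w2: "(c2 has_vector_derivative w2) (at t)"
  shows "((\<lambda>s. V (c1 s) (c2 s)) has_real_derivative
    - f (subtended_angle (c1 t) (c2 t)) * (w1 \<bullet> c2 t + c1 t \<bullet> w2)) (at t)"
proof -
  define r where "r s = c1 s \<bullet> c2 s" for s
  define W where "W r = V 1 (expi (arccos r))" for r
  have r: "cos (subtended_angle (c1 s) (c2 s)) = r s" for s
    unfolding r_def by (rule cos_subtended_angle [OF S3])
  have V: "V (c1 s) (c2 s) = W (r s)" for s
  proof -
    have "(1 :: quat) \<bullet> expi (arccos (r s)) = r s"
      using S3_inner_bounds [OF S3, of s s] by (simp add: inner_quat_def r_def)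
    then have "norm (c2 s - c1 s) = norm (expi (arccos (r s)) - 1)"
      using S3 by (subst (1 2) norm_diff_S3) (simp_all add: r_def [symmetric])
    moreover have "1 \<in> S3" "expi (arccos (r s)) \<in> S3" by simp_all
    ultimately show ?thesis
      using potential(1) S3 \<Theta> unfolding distance_potential_def W_def by blast
  qed
  have "range r \<subseteq> cos ` \<Theta>"
    using \<Theta> r by (metis image_eqI image_subsetI)
  moreover have "(W has_real_derivative - f (subtended_angle (c1 t) (c2 t))) (at (r t) within cos ` \<Theta>)"
    using potential(2) \<Theta> [of t] unfolding has_force_def W_def r [symmetric] by blast
  ultimately have "(W has_real_derivative - f (subtended_angle (c1 t) (c2 t))) (at (r t) within range r)"
    by (metis DERIV_subset)
  moreover have "(r has_real_derivative c1 t \<bullet> w2 + w1 \<bullet> c2 t) (at t)"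
    unfolding r_def by (rule has_real_derivative_inner [OF w1 w2])
  ultimately have "(W \<circ> r has_real_derivative
      - f (subtended_angle (c1 t) (c2 t)) * (c1 t \<bullet> w2 + w1 \<bullet> c2 t)) (at t)"
    by (rule DERIV_image_chain)
  moreover have "W \<circ> r = (\<lambda>s. V (c1 s) (c2 s))" by (simp add: V fun_eq_iff)
  ultimately show ?thesis by (simp only: add.commute)
qed

text \<open>The set \<open>\<Theta>\<close> contains the open interval. If the angle at
  \<open>t\<close> is an endpoint, that endpoint belongs to \<open>\<Theta>\<close> by assumption,
  and continuity only has to keep the curve away from the opposite one.\<close>

lemma eventually_angle:
  assumes S3: "\<And>s. c1 s \<in> S3" "\<And>s. c2 s \<in> S3"
    and \<Theta>: "subtended_angle (c1 t) (c2 t) \<in> \<Theta>"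
    and c: "isCont c1 t" "isCont c2 t"
  shows "\<forall>\<^sub>F s in nhds t. subtended_angle (c1 s) (c2 s) \<in> \<Theta>"
proof -
  define r where "r s = c1 s \<bullet> c2 s" for s
  have r: "isCont r t" unfolding r_def using c by (intro continuous_intros)
  define \<phi> where "\<phi> s = subtended_angle (c1 s) (c2 s)" for s
  have \<phi>: "cos (\<phi> s) = r s" "0 \<le> \<phi> s" "\<phi> s \<le> pi" for s
    unfolding \<phi>_def r_def using cos_subtended_angle S3 subtended_angle_bounds by auto
  have less: "\<forall>\<^sub>F s in nhds t. r s < 1" if "r t < 1"
    using order_tendstoD(2) [OF r [unfolded isCont_def] that] that
    by (simp add: eventually_nhds_conv_at)
  have greater: "\<forall>\<^sub>F s in nhds t. - 1 < r s" if "- 1 < r t"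
    using order_tendstoD(1) [OF r [unfolded isCont_def] that] that
    by (simp add: eventually_nhds_conv_at)
  have pos: "0 < \<phi> s" if "r s < 1" for s
    using \<phi> [of s] that by (cases "\<phi> s = 0") auto
  have less_pi: "\<phi> s < pi" if "- 1 < r s" for s
    using \<phi> [of s] that by (cases "\<phi> s = pi") auto
  have in\<Theta>: "\<phi> s \<in> \<Theta>" if "0 < \<phi> s" "\<phi> s < pi" for s
    using that angles by auto
  consider "r t = 1" | "r t = - 1" | "- 1 < r t" "r t < 1"
    using S3_inner_bounds [OF S3, of t t] unfolding r_def by linarith
  then have "\<forall>\<^sub>F s in nhds t. \<phi> s \<in> \<Theta>"
  proof cases
    case 1
    then have "\<phi> t = 0" using \<phi> [of t] cos_inj_pi [of "\<phi> t" 0] by simp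
    then have "0 \<in> \<Theta>" using \<Theta> by (simp add: \<phi>_def)
    from greater 1 have "\<forall>\<^sub>F s in nhds t. - 1 < r s" by simp
    then show ?thesis
      by eventually_elim (metis \<open>0 \<in> \<Theta>\<close> \<phi>(2) in\<Theta> less_pi order_le_less)
  next
    case 2
    then have "\<phi> t = pi" using \<phi> [of t] cos_inj_pi [of "\<phi> t" pi] by simp
    then have "pi \<in> \<Theta>" using \<Theta> by (simp add: \<phi>_def)
    from less 2 have "\<forall>\<^sub>F s in nhds t. r s < 1" by simp
    then show ?thesis
      by eventually_elim (metis \<open>pi \<in> \<Theta>\<close> \<phi>(3) in\<Theta> pos order_le_less)
  next
    case 3
    from less [OF 3(2)] greater [OF 3(1)] show ?thesis
      by eventually_elim (simp add: in\<Theta> pos less_pi)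
  qed
  then show ?thesis by (simp add: \<phi>_def)
qed

lemma hamiltonian_derivative:
  assumes M: "\<And>s. c s \<in> phase_space \<Theta>"
    and c: "(c has_vector_derivative (w1, q1, w2, q2)) (at t)"
    and ct: "c t = (g1, p1, g2, p2)"
  shows "((\<lambda>s. hamiltonian m1 m2 V (c s)) has_real_derivative
    p1 \<bullet> q1 / m1 + p2 \<bullet> q2 / m2 - f (subtended_angle g1 g2) * (w1 \<bullet> g2 + g1 \<bullet> w2)) (at t)"
proof -
  let ?g1 = "\<lambda>s. fst (c s)" and ?p1 = "\<lambda>s. fst (snd (c s))"
    and ?g2 = "\<lambda>s. fst (snd (snd (c s)))" and ?p2 = "\<lambda>s. snd (snd (snd (c s)))"
  note d = has_vector_derivative_phase [OF c]
  have M': "?g1 s \<in> S3" "?g2 s \<in> S3" "subtended_angle (?g1 s) (?g2 s) \<in> \<Theta>" for s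
    using M [of s] by (auto simp: phase_space_def)
  have V: "((\<lambda>s. V (?g1 s) (?g2 s)) has_real_derivative
      - f (subtended_angle g1 g2) * (w1 \<bullet> g2 + g1 \<bullet> w2)) (at t)"
    using potential_derivative [of ?g1 ?g2, OF M' d(1,3)] by (simp add: ct)
  have p1: "((\<lambda>s. (?p1 s \<bullet> ?p1 s) / (2 * m1)) has_real_derivative p1 \<bullet> q1 / m1) (at t)"
    using DERIV_cdivide [OF has_real_derivative_inner [OF d(2) d(2)], of "2 * m1"] masses
    by (simp add: ct inner_commute)
  have p2: "((\<lambda>s. (?p2 s \<bullet> ?p2 s) / (2 * m2)) has_real_derivative p2 \<bullet> q2 / m2) (at t)"
    using DERIV_cdivide [OF has_real_derivative_inner [OF d(4) d(4)], of "2 * m2"] masses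
    by (simp add: ct inner_commute)
  have H: "hamiltonian m1 m2 V (c s) =
      (?p1 s \<bullet> ?p1 s) / (2 * m1) + (?p2 s \<bullet> ?p2 s) / (2 * m2) + V (?g1 s) (?g2 s)" for s
    by (simp add: hamiltonian_def split_beta power2_norm_eq_inner)
  show ?thesis
    unfolding H using DERIV_add [OF DERIV_add [OF p1 p2] V] by simp
qed

text \<open>These curves supply the test directions for Hamilton's equation: \<open>z1\<close>,
  \<open>z2\<close> rotate position and momentum together, which keeps them orthogonal, and
  \<open>w1\<close>, \<open>w2\<close> change the momentum within the fibre.\<close>

lemma exists_curve_in_phase_space:
  assumes M: "(g1, p1, g2, p2) \<in> phase_space \<Theta>"
    and z: "z1 \<in> ImH" "z2 \<in> ImH" and w: "w1 \<bullet> g1 = 0" "w2 \<bullet> g2 = 0"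
  shows "\<exists>c. (\<forall>s. c s \<in> phase_space \<Theta>) \<and> c 0 = (g1, p1, g2, p2) \<and>
    (c has_vector_derivative (z1 * g1, z1 * p1 + w1, z2 * g2, z2 * p2 + w2)) (at (0 :: real))"
proof -
  define e where "e s = (exp (s *\<^sub>R z1) * g1, exp (s *\<^sub>R z1) * (p1 + s *\<^sub>R w1),
    exp (s *\<^sub>R z2) * g2, exp (s *\<^sub>R z2) * (p2 + s *\<^sub>R w2))" for s
  \<comment> \<open>away from \<open>0\<close> the curve \<open>e\<close> may reach an angle outside \<open>\<Theta>\<close>\<close>
  define c where "c s = (if e s \<in> phase_space \<Theta> then e s else (g1, p1, g2, p2))" for s
  note exp_derivative = exp_scaleR_has_vector_derivative_left [of _ 0, simplified]
  have ge: "((\<lambda>s. exp (s *\<^sub>R z) * g) has_vector_derivative z * g) (at 0)" for z g :: quat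
    using has_vector_derivative_mult [OF exp_derivative has_vector_derivative_const] by simp
  have pe: "((\<lambda>s. exp (s *\<^sub>R z) * (p + s *\<^sub>R w)) has_vector_derivative z * p + w) (at 0)" for z p w :: quat
  proof -
    have "((\<lambda>s. p + s *\<^sub>R w) has_vector_derivative w) (at 0)"
      by (auto intro!: derivative_eq_intros)
    from has_vector_derivative_mult [OF exp_derivative this] show ?thesis by (simp add: add.commute)
  qed
  have e: "(e has_vector_derivative (z1 * g1, z1 * p1 + w1, z2 * g2, z2 * p2 + w2)) (at 0)"
    unfolding e_def by (intro has_vector_derivative_Pair ge pe)
  have S3: "exp (s *\<^sub>R z1) * g1 \<in> S3" "exp (s *\<^sub>R z2) * g2 \<in> S3" for s
    using M exp_im_S3 [of "s *\<^sub>R z1"] exp_im_S3 [of "s *\<^sub>R z2"] z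
    by (auto simp: phase_space_def norm_mult)
  have orth: "(exp (s *\<^sub>R z1) * (p1 + s *\<^sub>R w1)) \<bullet> (exp (s *\<^sub>R z1) * g1) = 0"
    "(exp (s *\<^sub>R z2) * (p2 + s *\<^sub>R w2)) \<bullet> (exp (s *\<^sub>R z2) * g2) = 0" for s
    using M w inner_S3_mult [OF exp_im_S3 [of "s *\<^sub>R z1"], of 1] inner_S3_mult [OF exp_im_S3 [of "s *\<^sub>R z2"], of 1] z
    by (simp_all add: phase_space_def inner_add_left)
  \<comment> \<open>Near 0 the angle of \<open>e\<close> stays in \<open>\<Theta>\<close>, so
    \<open>c\<close> and \<open>e\<close> agree there and have the same derivative at 0.\<close>
  have "\<forall>\<^sub>F s in nhds 0. subtended_angle (exp (s *\<^sub>R z1) * g1) (exp (s *\<^sub>R z2) * g2) \<in> \<Theta>"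
    using S3 by (rule eventually_angle)
      (use M in \<open>auto simp: phase_space_def intro!: has_vector_derivative_continuous [OF ge]\<close>)
  then have "\<forall>\<^sub>F s in nhds 0. e s = c s"
    by eventually_elim (use S3 orth in \<open>simp add: c_def e_def phase_space_def\<close>)
  then have "(c has_vector_derivative (z1 * g1, z1 * p1 + w1, z2 * g2, z2 * p2 + w2)) (at 0)"
    using e has_vector_derivative_cong_ev [where S = UNIV and x = 0 and f = e and g = c] eventually_nhds_x_imp_x [of "\<lambda>s. e s = c s"]
    by simp
  then show ?thesis
    using M by (intro exI [of _ c]) (simp add: c_def e_def)
qed

end

text \<open>Fibre variations, tested on \<open>g' - p /\<^sub>R m\<close> itself, give the velocity.
  Rotations then show that \<open>p' - F *\<^sub>R h\<close> is orthogonal to all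
  \<open>z * g\<close>; these fill the complement of \<open>g\<close>, since
  \<open>v * qcnj g\<close> is imaginary whenever \<open>v\<close> is orthogonal to
  \<open>g\<close>. Only a multiple of \<open>g\<close> remains, the constraint force of the
  sphere.\<close>

lemma newton_equation_of_variations:
  fixes g g' h p p' :: quat
  assumes g: "g \<in> S3" "g' \<bullet> g = 0" "p \<bullet> g = 0"
    and w: "\<And>w. w \<bullet> g = 0 \<Longrightarrow> g' \<bullet> w = p \<bullet> w / m"
    and z: "\<And>z. z \<in> ImH \<Longrightarrow> g' \<bullet> (z * p) - p' \<bullet> (z * g) = p \<bullet> (z * p) / m - F * ((z * g) \<bullet> h)"
  shows "g' = p /\<^sub>R m" "\<exists>\<mu>. p' = F *\<^sub>R h + \<mu> *\<^sub>R g"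
proof -
  have "(g' - p /\<^sub>R m) \<bullet> g = 0" using g by (simp add: inner_diff_left)
  from w [OF this] have "(g' - p /\<^sub>R m) \<bullet> (g' - p /\<^sub>R m) = 0"
    by (simp add: inner_diff_left divide_inverse)
  then show g': "g' = p /\<^sub>R m" by simp
  define y where "y = p' - F *\<^sub>R h"
  have y: "y \<bullet> (z * g) = 0" if "z \<in> ImH" for z
    using z [OF that] by (simp add: y_def g' inner_diff_left inner_diff_right inner_commute divide_inverse)
  define v where "v = y - (y \<bullet> g) *\<^sub>R g"
  have vg: "v \<bullet> g = 0" using S3_inner_self [OF g(1)] by (simp add: v_def inner_diff_left)
  have "v * qcnj g \<in> ImH" using vg by (simp add: inner_quat_def)
  moreover have "v * qcnj g * g = v"
    using g(1) by (simp add: mult.assoc quat_mult_qcnj)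
  ultimately have "y \<bullet> v = 0" using y by metis
  then have "v \<bullet> v = 0" using vg by (simp add: v_def inner_diff_left inner_commute)
  then have "y = (y \<bullet> g) *\<^sub>R g" by (simp add: v_def)
  moreover have "p' = F *\<^sub>R h + y" by (simp add: y_def)
  ultimately have "p' = F *\<^sub>R h + (y \<bullet> g) *\<^sub>R g" by simp
  then show "\<exists>\<mu>. p' = F *\<^sub>R h + \<mu> *\<^sub>R g" ..
qed

lemma phase_velocity_tangent:
  assumes M: "\<And>s. c s \<in> phase_space \<Theta>"
    and c: "(c has_vector_derivative (w1, q1, w2, q2)) (at t)"
    and ct: "c t = (g1, p1, g2, p2)"
  shows "w1 \<bullet> g1 = 0" "w2 \<bullet> g2 = 0"
proof -
  note d = has_vector_derivative_phase [OF c]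
  have "fst (c s) \<bullet> fst (c s) = 1" "fst (snd (snd (c s))) \<bullet> fst (snd (snd (c s))) = 1" for s
    using M [of s] by (auto simp: phase_space_def dot_square_norm)
  from inner_constant_imp_derivative_eq_0 [OF d(1) d(1) this(1)]
    inner_constant_imp_derivative_eq_0 [OF d(3) d(3) this(2)]
  show "w1 \<bullet> g1 = 0" "w2 \<bullet> g2 = 0" by (simp_all add: ct inner_commute)
qed

section \<open>Hamilton's equations are equivalent to Newton's equations with multipliers\<close>

context two_body
begin

lemma hamiltonian_solution_imp_newton:
  assumes sol: "hamiltonian_solution (phase_space \<Theta>) (hamiltonian m1 m2 V) x"
    and xt: "x t = (g1, p1, g2, p2)"
  defines "F \<equiv> f (subtended_angle g1 g2)"
  shows "\<exists>\<mu>1 \<mu>2. (x has_vector_derivative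
    (p1 /\<^sub>R m1, F *\<^sub>R g2 + \<mu>1 *\<^sub>R g1, p2 /\<^sub>R m2, F *\<^sub>R g1 + \<mu>2 *\<^sub>R g2)) (at t)"
proof -
  have M: "x s \<in> phase_space \<Theta>" for s
    using sol by (simp add: hamiltonian_solution_def)
  obtain g1' p1' g2' p2' where x': "(x has_vector_derivative (g1', p1', g2', p2')) (at t)"
    and H: "\<And>c v. (\<forall>s. c s \<in> phase_space \<Theta>) \<Longrightarrow> c 0 = x t \<Longrightarrow> (c has_vector_derivative v) (at 0) \<Longrightarrow>
      ((\<lambda>s. hamiltonian m1 m2 V (c s)) has_real_derivative symplectic_form (g1', p1', g2', p2') v) (at 0)"
    using sol [unfolded hamiltonian_solution_def, rule_format, of t]
    by (auto simp del: split_paired_All)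
  have Mt: "g1 \<in> S3" "g2 \<in> S3" "p1 \<bullet> g1 = 0" "p2 \<bullet> g2 = 0"
    using M [of t] by (auto simp: xt phase_space_def)
  have variation: "g1' \<bullet> (z1 * p1 + w1) - p1' \<bullet> (z1 * g1) + g2' \<bullet> (z2 * p2 + w2) - p2' \<bullet> (z2 * g2)
      = p1 \<bullet> (z1 * p1 + w1) / m1 + p2 \<bullet> (z2 * p2 + w2) / m2 - F * ((z1 * g1) \<bullet> g2 + g1 \<bullet> (z2 * g2))"
    if z: "z1 \<in> ImH" "z2 \<in> ImH" "w1 \<bullet> g1 = 0" "w2 \<bullet> g2 = 0" for z1 z2 w1 w2
  proof -
    obtain c where c: "\<forall>s. c s \<in> phase_space \<Theta>" "c 0 = (g1, p1, g2, p2)"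
      "(c has_vector_derivative (z1 * g1, z1 * p1 + w1, z2 * g2, z2 * p2 + w2)) (at (0 :: real))"
      using exists_curve_in_phase_space [OF M [of t, unfolded xt] z] by blast
    from DERIV_unique [OF H [OF c(1) _ c(3)] hamiltonian_derivative [OF c(1)[rule_format] c(3,2)]] c(2)
    show ?thesis by (simp add: xt symplectic_form_def F_def)
  qed
  note tangent = phase_velocity_tangent [OF M x' xt]
  \<comment> \<open>Setting all variations of one particle to zero, and for the other either the
    rotation or the fibre part, isolates the four equations.\<close>
  have "g1' = p1 /\<^sub>R m1" "\<exists>\<mu>. p1' = F *\<^sub>R g2 + \<mu> *\<^sub>R g1"
    using newton_equation_of_variations [OF Mt(1) tangent(1) Mt(3), of m1 p1' F g2]
      variation [of 0 0 _ 0] variation [of _ 0 0 0] by simp_all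
  moreover have "g2' = p2 /\<^sub>R m2" "\<exists>\<mu>. p2' = F *\<^sub>R g1 + \<mu> *\<^sub>R g2"
    using newton_equation_of_variations [OF Mt(2) tangent(2) Mt(4), of m2 p2' F g1]
      variation [of 0 0 0] variation [of 0 _ 0 0] by (simp_all add: inner_commute [of g1])
  ultimately show ?thesis using x' by metis
qed

text \<open>The multipliers enter the symplectic form only through products of \<open>g1\<close>,
  \<open>g2\<close> with the velocities of the positions of the test curve, and these vanish by
  tangency to the spheres.\<close>

lemma newton_imp_hamiltonian_solution:
  assumes M: "\<And>t. x t \<in> phase_space \<Theta>"
    and newton: "\<And>t g1 p1 g2 p2. x t = (g1, p1, g2, p2) \<Longrightarrow> \<exists>\<mu>1 \<mu>2.
      (x has_vector_derivative (p1 /\<^sub>R m1, f (subtended_angle g1 g2) *\<^sub>R g2 + \<mu>1 *\<^sub>R g1,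
        p2 /\<^sub>R m2, f (subtended_angle g1 g2) *\<^sub>R g1 + \<mu>2 *\<^sub>R g2)) (at t)"
  shows "hamiltonian_solution (phase_space \<Theta>) (hamiltonian m1 m2 V) x"
  unfolding hamiltonian_solution_def
proof (intro allI conjI)
  fix t
  show "x t \<in> phase_space \<Theta>" by (rule M)
  obtain g1 p1 g2 p2 where xt: "x t = (g1, p1, g2, p2)" using prod_cases4 by blast
  obtain x' \<mu>1 \<mu>2 where x': "(x has_vector_derivative x') (at t)"
    and x'_eq: "x' = (p1 /\<^sub>R m1, f (subtended_angle g1 g2) *\<^sub>R g2 + \<mu>1 *\<^sub>R g1,
        p2 /\<^sub>R m2, f (subtended_angle g1 g2) *\<^sub>R g1 + \<mu>2 *\<^sub>R g2)"
    using newton [OF xt] by blast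
  have "((\<lambda>s. hamiltonian m1 m2 V (c s)) has_real_derivative symplectic_form x' v) (at 0)"
    if c: "\<forall>s. c s \<in> phase_space \<Theta>" "c 0 = x t" and v: "(c has_vector_derivative v) (at 0)" for c v
  proof -
    obtain w1 q1 w2 q2 where v_eq: "v = (w1, q1, w2, q2)" using prod_cases4 by blast
    have c0: "c 0 = (g1, p1, g2, p2)" using c xt by simp
    note tangent = phase_velocity_tangent [OF c(1)[rule_format] v [unfolded v_eq] c0]
    show ?thesis
      using hamiltonian_derivative [OF c(1)[rule_format] v [unfolded v_eq] c0] tangent
      by (simp add: symplectic_form_def v_eq x'_eq inner_add_left inner_commute algebra_simps divide_inverse)
  qed
  with x' show "\<exists>x'. (x has_vector_derivative x') (at t) \<and>
      (\<forall>c v. (\<forall>s. c s \<in> phase_space \<Theta>) \<and> c 0 = x t \<and> (c has_vector_derivative v) (at 0) \<longrightarrow>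
        ((\<lambda>s. hamiltonian m1 m2 V (c s)) has_real_derivative symplectic_form x' v) (at 0))"
    by blast
qed

end

section \<open>Relative equilibria as balanced configurations\<close>

lemma one_parameter_motion_derivative:
  fixes g \<xi> \<eta> :: quat
  shows "((\<lambda>t. exp (t *\<^sub>R \<xi>) * g * inverse (exp (t *\<^sub>R \<eta>))) has_vector_derivative
    exp (t *\<^sub>R \<xi>) * (\<xi> * g - g * \<eta>) * inverse (exp (t *\<^sub>R \<eta>))) (at t)"
proof -
  have l: "((\<lambda>t. exp (t *\<^sub>R \<xi>) * g) has_vector_derivative exp (t *\<^sub>R \<xi>) * \<xi> * g) (at t)"
    using has_vector_derivative_mult [OF exp_scaleR_has_vector_derivative_right has_vector_derivative_const]
    by simp
  have r: "((\<lambda>t. inverse (exp (t *\<^sub>R \<eta>))) has_vector_derivative - \<eta> * inverse (exp (t *\<^sub>R \<eta>))) (at t)"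
    using exp_scaleR_has_vector_derivative_left [of "- \<eta>" t] by (simp add: exp_uminus_eq_inverse)
  from has_vector_derivative_mult [OF l r] show ?thesis
    by (simp add: algebra_simps)
qed

text \<open>Squares of imaginary quaternions are negative scalars, so apart from a multiple of
  \<open>g\<close> only the mixed term survives.\<close>

lemma one_parameter_acceleration:
  fixes g \<xi> \<eta> :: quat
  assumes "\<xi> \<in> ImH" "\<eta> \<in> ImH"
  shows "\<xi> * (\<xi> * g - g * \<eta>) - (\<xi> * g - g * \<eta>) * \<eta> =
    - ((norm \<xi>)\<^sup>2 + (norm \<eta>)\<^sup>2) *\<^sub>R g - 2 *\<^sub>R (\<xi> * g * \<eta>)"
proof -
  have "\<xi> * (\<xi> * g - g * \<eta>) - (\<xi> * g - g * \<eta>) * \<eta> =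
      \<xi> * \<xi> * g - \<xi> * g * \<eta> - \<xi> * g * \<eta> + g * (\<eta> * \<eta>)"
    by (simp add: algebra_simps)
  with assms show ?thesis
    by (simp add: quat_im_square scaleR_2 algebra_simps)
qed

section \<open>Newton's equations along an orbit reduce to balance equations at time 0\<close>

context two_body
begin

text \<open>The multipliers absorb both the constraint forces and the centripetal terms, so neither
  the momenta nor the sum of the squared norms of the generators appears.\<close>

definition balanced :: "quat \<Rightarrow> quat \<Rightarrow> quat \<Rightarrow> quat \<Rightarrow> bool" where
  "balanced \<xi> \<eta> g1 g2 \<longleftrightarrow> (\<exists>\<mu>1 \<mu>2.
     (- 2 * m1) *\<^sub>R (\<xi> * g1 * \<eta>) = f (subtended_angle g1 g2) *\<^sub>R g2 + \<mu>1 *\<^sub>R g1 \<and>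
     (- 2 * m2) *\<^sub>R (\<xi> * g2 * \<eta>) = f (subtended_angle g1 g2) *\<^sub>R g1 + \<mu>2 *\<^sub>R g2)"

text \<open>The orbit is differentiated at time 0 and compared with Newton's equations: the position
  components give the momenta, the momentum components the balance equations.\<close>

lemma relative_equilibrium_imp_balanced:
  assumes re: "relative_equilibrium \<Theta> m1 m2 V \<xi> \<eta> x"
    and x0: "x 0 = (g1, p1, g2, p2)"
  shows "p1 = m1 *\<^sub>R (\<xi> * g1 - g1 * \<eta>)" "p2 = m2 *\<^sub>R (\<xi> * g2 - g2 * \<eta>)" "balanced \<xi> \<eta> g1 g2"
proof -
  let ?F = "f (subtended_angle g1 g2)"
  have im: "\<xi> \<in> ImH" "\<eta> \<in> ImH"
    and x: "x t = act (exp (t *\<^sub>R \<xi>)) (exp (t *\<^sub>R \<eta>)) (g1, p1, g2, p2)" for t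
    using re x0 unfolding relative_equilibrium_def by metis+
  have "(x has_vector_derivative (\<xi> * g1 - g1 * \<eta>, \<xi> * p1 - p1 * \<eta>, \<xi> * g2 - g2 * \<eta>, \<xi> * p2 - p2 * \<eta>)) (at 0)"
  proof -
    note d = one_parameter_motion_derivative [of \<xi> _ \<eta> 0, simplified]
    show ?thesis
      unfolding ext [of x, OF x] act_def split_conv by (intro has_vector_derivative_Pair d)
  qed
  moreover obtain \<mu>1 \<mu>2 where "(x has_vector_derivative
      (p1 /\<^sub>R m1, ?F *\<^sub>R g2 + \<mu>1 *\<^sub>R g1, p2 /\<^sub>R m2, ?F *\<^sub>R g1 + \<mu>2 *\<^sub>R g2)) (at 0)"
    using hamiltonian_solution_imp_newton [where x = x and t = 0, OF _ x0] re unfolding relative_equilibrium_def by blast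
  ultimately have eq: "\<xi> * g1 - g1 * \<eta> = p1 /\<^sub>R m1" "\<xi> * g2 - g2 * \<eta> = p2 /\<^sub>R m2"
    and eq': "\<xi> * p1 - p1 * \<eta> = ?F *\<^sub>R g2 + \<mu>1 *\<^sub>R g1" "\<xi> * p2 - p2 * \<eta> = ?F *\<^sub>R g1 + \<mu>2 *\<^sub>R g2"
    using vector_derivative_unique_at by blast+
  show p: "p1 = m1 *\<^sub>R (\<xi> * g1 - g1 * \<eta>)" "p2 = m2 *\<^sub>R (\<xi> * g2 - g2 * \<eta>)"
    using masses unfolding eq by simp_all
  have acc: "m *\<^sub>R (\<xi> * (\<xi> * g - g * \<eta>) - (\<xi> * g - g * \<eta>) * \<eta>) = \<xi> * p - p * \<eta>"
    if "p = m *\<^sub>R (\<xi> * g - g * \<eta>)" for m p g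
    unfolding that by (simp add: algebra_simps)
  let ?k = "(norm \<xi>)\<^sup>2 + (norm \<eta>)\<^sup>2"
  have rearrange: "(- 2 * m) *\<^sub>R q = m *\<^sub>R (- k *\<^sub>R g - 2 *\<^sub>R q) + (m * k) *\<^sub>R g" for m k and q g :: quat
    by (simp add: algebra_simps)
  have "(- 2 * m1) *\<^sub>R (\<xi> * g1 * \<eta>) = ?F *\<^sub>R g2 + (\<mu>1 + m1 * ?k) *\<^sub>R g1"
    unfolding rearrange [of m1 _ ?k g1] using acc [OF p(1)] unfolding eq' one_parameter_acceleration [OF im]
    by (simp add: scaleR_add_left)
  moreover have "(- 2 * m2) *\<^sub>R (\<xi> * g2 * \<eta>) = ?F *\<^sub>R g1 + (\<mu>2 + m2 * ?k) *\<^sub>R g2"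
    unfolding rearrange [of m2 _ ?k g2] using acc [OF p(2)] unfolding eq' one_parameter_acceleration [OF im]
    by (simp add: scaleR_add_left)
  ultimately show "balanced \<xi> \<eta> g1 g2" unfolding balanced_def by blast
qed

lemma subtended_angle_act: "subtended_angle (l * g * inverse r) (l * h * inverse r) = subtended_angle g h"
  if "l \<in> S3" "r \<in> S3"
  using that inner_S3_mult [of l "inverse r" g h] by (simp add: subtended_angle_def norm_inverse)

text \<open>The group acts by isometries, so the angle and the force are constant along the orbit,
  and Newton's equations at time \<open>t\<close> are the image of those at time 0.\<close>

lemma balanced_imp_relative_equilibrium:
  assumes im: "\<xi> \<in> ImH" "\<eta> \<in> ImH"
    and g: "g1 \<in> S3" "g2 \<in> S3" "subtended_angle g1 g2 \<in> \<Theta>"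
    and bal: "balanced \<xi> \<eta> g1 g2"
    and x: "\<And>t. x t = act (exp (t *\<^sub>R \<xi>)) (exp (t *\<^sub>R \<eta>))
      (g1, m1 *\<^sub>R (\<xi> * g1 - g1 * \<eta>), g2, m2 *\<^sub>R (\<xi> * g2 - g2 * \<eta>))"
  shows "relative_equilibrium \<Theta> m1 m2 V \<xi> \<eta> x"
proof -
  let ?F = "f (subtended_angle g1 g2)"
  let ?e = "\<lambda>t. exp (t *\<^sub>R \<xi>)" and ?h = "\<lambda>t. exp (t *\<^sub>R \<eta>)"
  have e: "?e t \<in> S3" "?h t \<in> S3" "inverse (?h t) \<in> S3" for t
    using exp_im_S3 [of "t *\<^sub>R \<xi>"] exp_im_S3 [of "t *\<^sub>R \<eta>"] im by (simp_all add: norm_inverse)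
  have orth: "(\<xi> * g - g * \<eta>) \<bullet> g = 0" for g
    using inner_mult_im(1) [OF im(1)] inner_mult_im(2) [OF im(2)]
    by (simp add: inner_diff_left inner_diff_right inner_commute)
  have M: "x t \<in> phase_space \<Theta>" for t
    unfolding x act_def phase_space_def split_conv mem_Collect_eq
      subtended_angle_act [OF e(1,2)] inner_S3_mult [OF e(1,3)]
    using g e by (auto simp: norm_mult orth)
  have sol: "hamiltonian_solution (phase_space \<Theta>) (hamiltonian m1 m2 V) x"
  proof (rule newton_imp_hamiltonian_solution [OF M])
    fix t h1 p1 h2 p2
    assume xt: "x t = (h1, p1, h2, p2)"
    have h: "h1 = ?e t * g1 * inverse (?h t)" "h2 = ?e t * g2 * inverse (?h t)"
      "p1 = ?e t * m1 *\<^sub>R (\<xi> * g1 - g1 * \<eta>) * inverse (?h t)"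
      "p2 = ?e t * m2 *\<^sub>R (\<xi> * g2 - g2 * \<eta>) * inverse (?h t)"
      using xt unfolding x act_def by simp_all
    have F: "f (subtended_angle h1 h2) = ?F"
      unfolding h subtended_angle_act [OF e(1,2)] ..
    obtain \<mu>1 \<mu>2 where
      1: "(- 2 * m1) *\<^sub>R (\<xi> * g1 * \<eta>) = ?F *\<^sub>R g2 + \<mu>1 *\<^sub>R g1" and
      2: "(- 2 * m2) *\<^sub>R (\<xi> * g2 * \<eta>) = ?F *\<^sub>R g1 + \<mu>2 *\<^sub>R g2"
      using bal unfolding balanced_def by blast
    let ?k = "(norm \<xi>)\<^sup>2 + (norm \<eta>)\<^sup>2"
    \<comment> \<open>The acceleration differs from the mixed term by a multiple of
      \<open>g\<close>, which shifts the multiplier from \<open>\<mu>\<close> to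
      \<open>\<mu> - m * ?k\<close>.\<close>
    have acc: "?e t * (\<xi> * m *\<^sub>R (\<xi> * g - g * \<eta>) - m *\<^sub>R (\<xi> * g - g * \<eta>) * \<eta>) * inverse (?h t) =
        F *\<^sub>R (?e t * g' * inverse (?h t)) + (\<mu> - m * ?k) *\<^sub>R (?e t * g * inverse (?h t))"
      if "(- 2 * m) *\<^sub>R (\<xi> * g * \<eta>) = F *\<^sub>R g' + \<mu> *\<^sub>R g" for m g g' \<mu> F
    proof -
      have "\<xi> * m *\<^sub>R (\<xi> * g - g * \<eta>) - m *\<^sub>R (\<xi> * g - g * \<eta>) * \<eta> =
          m *\<^sub>R (\<xi> * (\<xi> * g - g * \<eta>) - (\<xi> * g - g * \<eta>) * \<eta>)"
        by (simp add: algebra_simps)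
      also have "\<dots> = (- 2 * m) *\<^sub>R (\<xi> * g * \<eta>) - (m * ?k) *\<^sub>R g"
        unfolding one_parameter_acceleration [OF im] by (simp add: algebra_simps)
      also have "\<dots> = F *\<^sub>R g' + (\<mu> - m * ?k) *\<^sub>R g"
        unfolding that by (simp add: algebra_simps)
      finally show ?thesis by (simp add: distrib_left distrib_right)
    qed
    note d = one_parameter_motion_derivative [of \<xi> _ \<eta> t]
    have "(x has_vector_derivative
       (?e t * (\<xi> * g1 - g1 * \<eta>) * inverse (?h t),
        ?e t * (\<xi> * m1 *\<^sub>R (\<xi> * g1 - g1 * \<eta>) - m1 *\<^sub>R (\<xi> * g1 - g1 * \<eta>) * \<eta>) * inverse (?h t),
        ?e t * (\<xi> * g2 - g2 * \<eta>) * inverse (?h t),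
        ?e t * (\<xi> * m2 *\<^sub>R (\<xi> * g2 - g2 * \<eta>) - m2 *\<^sub>R (\<xi> * g2 - g2 * \<eta>) * \<eta>) * inverse (?h t))) (at t)"
      unfolding ext [of x, OF x] act_def split_conv by (intro has_vector_derivative_Pair d)
    moreover have "?e t * (\<xi> * g1 - g1 * \<eta>) * inverse (?h t) = p1 /\<^sub>R m1"
      "?e t * (\<xi> * g2 - g2 * \<eta>) * inverse (?h t) = p2 /\<^sub>R m2"
      unfolding h using masses by simp_all
    ultimately show "\<exists>\<mu>1 \<mu>2. (x has_vector_derivative
        (p1 /\<^sub>R m1, f (subtended_angle h1 h2) *\<^sub>R h2 + \<mu>1 *\<^sub>R h1,
         p2 /\<^sub>R m2, f (subtended_angle h1 h2) *\<^sub>R h1 + \<mu>2 *\<^sub>R h2)) (at t)"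
      unfolding F unfolding acc [OF 1] acc [OF 2] h(1,2) by metis
  qed
  have "x t = act (?e t) (?h t) (x 0)" for t
    unfolding x [of t] x [of 0] by (simp add: act_def)
  with im sol show ?thesis unfolding relative_equilibrium_def by blast
qed

end

section \<open>Standard motions as orbits, and conjugation into them\<close>

lemma standard_motion_eq_act:
  "standard_motion m1 m2 a b g1 g2 t = act (exp (t *\<^sub>R a *\<^sub>R qj)) (exp (t *\<^sub>R b *\<^sub>R qj))
     (g1, m1 *\<^sub>R (a *\<^sub>R qj * g1 - g1 * b *\<^sub>R qj), g2, m2 *\<^sub>R (a *\<^sub>R qj * g2 - g2 * b *\<^sub>R qj))"
proof -
  have j: "j_motion a b g = (\<lambda>t. exp (t *\<^sub>R a *\<^sub>R qj) * g * inverse (exp (t *\<^sub>R b *\<^sub>R qj)))" for g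
    by (simp add: j_motion_def exp_uminus_eq_inverse fun_eq_iff)
  have v: "vector_derivative (j_motion a b g) (at t) =
      exp (t *\<^sub>R a *\<^sub>R qj) * (a *\<^sub>R qj * g - g * b *\<^sub>R qj) * inverse (exp (t *\<^sub>R b *\<^sub>R qj))" for g
    unfolding j by (rule vector_derivative_at [OF one_parameter_motion_derivative])
  show ?thesis
    unfolding standard_motion_def v by (simp add: j act_def)
qed

lemma standard_motion_0:
  "standard_motion m1 m2 a b g1 g2 0 =
     (g1, m1 *\<^sub>R (a *\<^sub>R qj * g1 - g1 * b *\<^sub>R qj), g2, m2 *\<^sub>R (a *\<^sub>R qj * g2 - g2 * b *\<^sub>R qj))"
  by (simp add: standard_motion_eq_act act_def)

context two_body
begin

lemma relative_equilibrium_standard_motion_iff: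
  assumes "g1 \<in> S3" "g2 \<in> S3" "subtended_angle g1 g2 \<in> \<Theta>"
  shows "relative_equilibrium \<Theta> m1 m2 V (a *\<^sub>R qj) (b *\<^sub>R qj) (standard_motion m1 m2 a b g1 g2)
    \<longleftrightarrow> balanced (a *\<^sub>R qj) (b *\<^sub>R qj) g1 g2"
  using relative_equilibrium_imp_balanced(3) [where x = "standard_motion m1 m2 a b g1 g2", OF _ standard_motion_0]
    balanced_imp_relative_equilibrium [OF _ _ assms _ standard_motion_eq_act]
  by auto

text \<open>Intertwining the generators intertwines their exponentials, and the initial momenta
  correspond because they are fixed by the generators. The coefficients \<open>a\<close>,
  \<open>b\<close> may have any sign, which the singular case uses.\<close>

lemma conjugate_standard_motionI:
  assumes re: "relative_equilibrium \<Theta> m1 m2 V \<xi> \<eta> x"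
    and x0: "x 0 = (g1, p1, g2, p2)"
    and l: "l \<in> S3" "r \<in> S3"
    and \<xi>: "l * \<xi> = a *\<^sub>R qj * l" and \<eta>: "r * \<eta> = b *\<^sub>R qj * r"
  shows "conjugate x (standard_motion m1 m2 a b (l * g1 * inverse r) (l * g2 * inverse r))"
proof -
  have l0: "l \<noteq> 0" "r \<noteq> 0" using l by auto
  have \<xi>': "a *\<^sub>R qj = l * \<xi> * inverse l" and \<eta>': "b *\<^sub>R qj = r * \<eta> * inverse r"
    using l0 by (simp_all only: \<xi> \<eta> mult.assoc right_inverse not_False_eq_True mult_1_right)
  have e: "exp (t *\<^sub>R a *\<^sub>R qj) * l = l * exp (t *\<^sub>R \<xi>)"
    "inverse r * inverse (exp (t *\<^sub>R b *\<^sub>R qj)) = inverse (exp (t *\<^sub>R \<eta>)) * inverse r" for t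
  proof -
    have "exp (t *\<^sub>R a *\<^sub>R qj) = l * exp (t *\<^sub>R \<xi>) * inverse l"
      unfolding \<xi>' using exp_conjugate [OF l0(1), of "t *\<^sub>R \<xi>"] by simp
    then show "exp (t *\<^sub>R a *\<^sub>R qj) * l = l * exp (t *\<^sub>R \<xi>)" using l0 by (simp add: mult.assoc)
    have "exp (t *\<^sub>R b *\<^sub>R qj) = r * exp (t *\<^sub>R \<eta>) * inverse r"
      unfolding \<eta>' using exp_conjugate [OF l0(2), of "t *\<^sub>R \<eta>"] by simp
    then have "exp (t *\<^sub>R b *\<^sub>R qj) * r = r * exp (t *\<^sub>R \<eta>)" using l0 by (simp add: mult.assoc)
    then have "inverse (exp (t *\<^sub>R b *\<^sub>R qj) * r) = inverse (r * exp (t *\<^sub>R \<eta>))" by (rule arg_cong)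
    then show "inverse r * inverse (exp (t *\<^sub>R b *\<^sub>R qj)) = inverse (exp (t *\<^sub>R \<eta>)) * inverse r"
      using l0 by (simp add: nonzero_inverse_mult_distrib)
  qed
  have A: "exp (t *\<^sub>R a *\<^sub>R qj) * (l * q * inverse r) * inverse (exp (t *\<^sub>R b *\<^sub>R qj)) =
      l * (exp (t *\<^sub>R \<xi>) * q * inverse (exp (t *\<^sub>R \<eta>))) * inverse r" for q t
    by (simp only: mult.assoc e(2), simp only: mult.assoc [symmetric] e(1))
  have p: "a *\<^sub>R qj * (l * g * inverse r) - (l * g * inverse r) * b *\<^sub>R qj =
      l * (\<xi> * g - g * \<eta>) * inverse r" for g
  proof -
    have "a *\<^sub>R qj * (l * g * inverse r) = l * \<xi> * g * inverse r"
      unfolding \<xi> by (simp only: mult.assoc)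
    moreover have "(l * g * inverse r) * b *\<^sub>R qj = l * g * (inverse r * r) * \<eta> * inverse r"
      unfolding \<eta>' by (simp only: mult.assoc)
    ultimately show ?thesis using l0 by (simp add: algebra_simps)
  qed
  note bal = relative_equilibrium_imp_balanced [OF re x0]
  have x: "x t = act (exp (t *\<^sub>R \<xi>)) (exp (t *\<^sub>R \<eta>)) (g1, p1, g2, p2)" for t
    using re x0 unfolding relative_equilibrium_def by metis
  have "standard_motion m1 m2 a b (l * g1 * inverse r) (l * g2 * inverse r) t = act l r (x t)" for t
  proof -
    have "standard_motion m1 m2 a b (l * g1 * inverse r) (l * g2 * inverse r) t =
      act (exp (t *\<^sub>R a *\<^sub>R qj)) (exp (t *\<^sub>R b *\<^sub>R qj))
        (l * g1 * inverse r, l * p1 * inverse r, l * g2 * inverse r, l * p2 * inverse r)"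
      unfolding standard_motion_eq_act p bal(1,2) by simp
    also have "\<dots> = act l r (x t)" unfolding x act_def split_conv A ..
    finally show ?thesis .
  qed
  with l show ?thesis unfolding conjugate_def by blast
qed

lemma balanced_act:
  assumes l: "l \<in> S3" "r \<in> S3"
    and \<xi>: "l * \<xi> = \<xi>' * l" and \<eta>: "r * \<eta> = \<eta>' * r"
    and bal: "balanced \<xi> \<eta> g1 g2"
  shows "balanced \<xi>' \<eta>' (l * g1 * inverse r) (l * g2 * inverse r)"
proof -
  have l0: "l \<noteq> 0" "r \<noteq> 0" using l by auto
  have \<eta>': "inverse r * \<eta>' = \<eta> * inverse r"
  proof -
    have "inverse r * \<eta>' = inverse r * (\<eta>' * r) * inverse r"
      using l0 by (simp add: mult.assoc)
    also have "\<dots> = inverse r * r * \<eta> * inverse r"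
      unfolding \<eta> [symmetric] by (simp only: mult.assoc)
    finally show ?thesis using l0 by simp
  qed
  have "\<xi>' * (l * g * inverse r) * \<eta>' = l * (\<xi> * g * \<eta>) * inverse r" for g
    by (simp add: mult.assoc \<eta>') (simp add: mult.assoc [symmetric] \<xi>)
  moreover have "c *\<^sub>R (l * h * inverse r) = d *\<^sub>R (l * h' * inverse r) + e *\<^sub>R (l * h'' * inverse r)"
    if "c *\<^sub>R h = d *\<^sub>R h' + e *\<^sub>R h''" for c d e h h' h''
    using arg_cong [OF that, of "\<lambda>q. l * q * inverse r"] by (simp add: distrib_left distrib_right)
  ultimately show ?thesis
    using bal unfolding balanced_def subtended_angle_act [OF l] by metis
qed

end

section \<open>Normal forms\<close>

lemma S3_inner_eq_1_iff: "g \<bullet> h = 1 \<longleftrightarrow> h = g" if "g \<in> S3" "h \<in> S3"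
  using norm_diff_S3 [OF that] S3_inner_self [OF that(1)] by auto

lemma S3_inner_eq_minus_1_iff: "g \<bullet> h = - 1 \<longleftrightarrow> h = - g" if "g \<in> S3" "h \<in> S3"
  using S3_inner_eq_1_iff [of "- g" h] that by auto

lemma im_intertwines_j:
  assumes "u \<in> ImH"
  shows "\<exists>l\<in>S3. l * u = norm u *\<^sub>R qj * l"
proof (cases "u = 0")
  case True
  then show ?thesis by (intro bexI [of _ 1]) auto
next
  case False
  then have "sgn u * sgn u = - 1"
    using assms quat_im_square [of "sgn u"] by (simp add: norm_sgn sgn_div_norm)
  then obtain l where l: "l \<in> S3" "l * sgn u = qj * l"
    using exists_rotation_to_j by blast
  have "l * u = l * norm u *\<^sub>R sgn u" using False by (simp add: sgn_div_norm)
  also have "\<dots> = norm u *\<^sub>R qj * l" using l(2) by simp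
  finally show ?thesis using l(1) by blast
qed

text \<open>The map \<open>q \<mapsto> u * q * v\<close> is an orthogonal involution; its eigenvectors
  \<open>g1 - u * g1 * v\<close> and \<open>g1 + u * g1 * v\<close> span the plane of \<open>g1\<close> and \<open>g2\<close> and are moved to
  the real and the \<open>i\<close>-axis.\<close>

lemma invariant_plane_normal_form:
  fixes \<xi> \<eta> g1 g2 :: quat
  assumes im: "\<xi> \<in> ImH" "\<eta> \<in> ImH"
    and g: "g1 \<in> S3" "g2 \<in> S3" "g1 \<bullet> g2 \<noteq> 1" "g1 \<bullet> g2 \<noteq> - 1"
    and plane: "\<xi> * g1 * \<eta> = \<alpha> *\<^sub>R g2 + \<mu> *\<^sub>R g1" "\<alpha> \<noteq> 0"
  shows "\<exists>l\<in>S3. \<exists>r\<in>S3. l * \<xi> = norm \<xi> *\<^sub>R qj * l \<and> r * \<eta> = norm \<eta> *\<^sub>R qj * r \<and>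
    qim2 (l * g1 * inverse r) = 0 \<and> qim3 (l * g1 * inverse r) = 0 \<and>
    qim2 (l * g2 * inverse r) = 0 \<and> qim3 (l * g2 * inverse r) = 0"
proof -
  \<comment> \<open>Unit vectors that are parallel are equal or opposite, which the inner product
    excludes.\<close>
  have not_parallel: "g2 \<noteq> c *\<^sub>R g1" for c
  proof
    assume *: "g2 = c *\<^sub>R g1"
    then have "norm g2 = \<bar>c\<bar> * norm g1" by simp
    with g have "c = 1 \<or> c = - 1" by auto
    with * g show False by (auto simp: S3_inner_self)
  qed
  have g2: "g2 = inverse \<alpha> *\<^sub>R (\<xi> * g1 * \<eta>) - (\<mu> / \<alpha>) *\<^sub>R g1"
    using plane by (simp add: scaleR_add_right divide_inverse mult.commute)
  have nz: "\<xi> \<noteq> 0" "\<eta> \<noteq> 0"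
    using g2 not_parallel [of "- (\<mu> / \<alpha>)"] by auto
  define u where "u = sgn \<xi>"
  define v where "v = sgn \<eta>"
  have u: "u \<in> ImH" "norm u = 1" "\<xi> = norm \<xi> *\<^sub>R u" "u * u = - 1"
    using im(1) nz quat_im_square [of u] by (simp_all add: u_def sgn_div_norm)
  have v: "v \<in> ImH" "norm v = 1" "\<eta> = norm \<eta> *\<^sub>R v" "v * v = - 1"
    using im(2) nz quat_im_square [of v] by (simp_all add: v_def sgn_div_norm)
  define h where "h = u * g1 * v"
  have \<xi>h: "\<xi> * g1 * \<eta> = (norm \<xi> * norm \<eta>) *\<^sub>R h"
    unfolding h_def by (subst u(3), subst v(3)) simp
  have not_par: "h \<noteq> c *\<^sub>R g1" for c
  proof
    assume "h = c *\<^sub>R g1"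
    with g2 \<xi>h have "g2 = (inverse \<alpha> * (norm \<xi> * norm \<eta> * c) - \<mu> / \<alpha>) *\<^sub>R g1"
      by (simp add: algebra_simps)
    with not_parallel show False by blast
  qed
  define em where "em = g1 - h"
  define ep where "ep = g1 + h"
  have nz': "em \<noteq> 0" "ep \<noteq> 0"
    using not_par [of 1] not_par [of "- 1"] by (auto simp: em_def ep_def eq_neg_iff_add_eq_0 add.commute)
  have hv: "h * v = - (u * g1)"
    by (simp add: h_def mult.assoc v(4))
  have uh: "u * h = - (g1 * v)"
    by (simp add: h_def mult.assoc [symmetric] u(4))
  \<comment> \<open>Under \<open>q \<mapsto> u * q * v\<close> the vectors \<open>em\<close> and
    \<open>ep\<close> have eigenvalues -1 and 1. Multiplying by \<open>v\<close> on the right turns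
    this into the two relations here.\<close>
  have um: "u * em = em * v" and up: "u * ep = - (ep * v)"
    by (simp_all add: em_def ep_def algebra_simps uh hv)
  \<comment> \<open>This unit quaternion carries the line of \<open>em\<close> to that of
    \<open>ep\<close>. It is imaginary because they are orthogonal and anticommutes with
    \<open>u\<close> because their eigenvalues are opposite, so \<open>w\<close>, \<open>u\<close>
    can be rotated to \<open>qi\<close>, \<open>qj\<close> together.\<close>
  define w where "w = sgn (ep * qcnj em)"
  have nzw: "ep * qcnj em \<noteq> 0"
    using nz' by (metis mult_eq_0_iff norm_eq_zero norm_qcnj)
  have "h \<bullet> h = 1"
    using u v g by (simp add: h_def dot_square_norm norm_mult)
  then have "ep \<bullet> em = 0"
    using S3_inner_self [OF g(1)] by (simp add: em_def ep_def inner_add_left inner_add_right inner_diff_left inner_diff_right inner_commute)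
  then have "ep * qcnj em \<in> ImH" by (simp add: inner_quat_def)
  then have w: "w * w = - 1"
    using nzw quat_im_square [of w] by (simp add: w_def sgn_div_norm)
  have qu: "qcnj u = - u" "qcnj v = - v"
    using u(1) v(1) by (simp_all add: quat_eq_iff)
  have "qcnj em * u = v * qcnj em"
    using arg_cong [OF um, of qcnj] by (simp add: qcnj_mult qu)
  then have "u * (ep * qcnj em) = - (ep * qcnj em * u)"
    by (simp add: mult.assoc) (simp add: mult.assoc [symmetric] up)
  then have uw: "u * w = - (w * u)"
    by (simp add: w_def sgn_div_norm)
  obtain l where l: "l \<in> S3" "l * w = qi * l" "l * u = qj * l"
    using exists_rotation_to_ij [OF w u(4) uw] by blast
  \<comment> \<open>With this choice \<open>em\<close> goes to a positive real number, and
    \<open>ep\<close>, being a multiple of \<open>w * em\<close>, goes to the axis of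
    \<open>qi\<close>.\<close>
  define r where "r = l * sgn em"
  have r: "r \<in> S3" using l nz' by (simp add: r_def norm_mult norm_sgn)
  have "l * \<xi> = norm \<xi> *\<^sub>R (l * u)" by (subst u(3)) simp
  then have l\<xi>: "l * \<xi> = norm \<xi> *\<^sub>R qj * l" using l by simp
  have "r * v = l * (u * sgn em)"
    using um by (simp add: r_def sgn_div_norm mult.assoc)
  then have "r * v = qj * r"
    using l by (simp add: r_def mult.assoc [symmetric])
  moreover have "r * \<eta> = norm \<eta> *\<^sub>R (r * v)" by (subst v(3)) simp
  ultimately have r\<eta>: "r * \<eta> = norm \<eta> *\<^sub>R qj * r" by simp
  have "em = norm em *\<^sub>R sgn em" using nz' by (simp add: sgn_div_norm)
  then have "l * em = norm em *\<^sub>R r" by (metis r_def mult_scaleR_right)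
  moreover have "r \<noteq> 0" using r by auto
  ultimately have lem: "l * em * inverse r = norm em *\<^sub>R 1" by simp
  have "ep = (ep * qcnj em) * em /\<^sub>R (norm em)\<^sup>2"
    using nz' by (simp add: mult.assoc quat_mult_qcnj)
  also have "ep * qcnj em = norm (ep * qcnj em) *\<^sub>R w"
    using nzw by (simp add: w_def sgn_div_norm)
  finally obtain c where ep: "ep = c *\<^sub>R (w * em)" by (metis mult_scaleR_left scaleR_scaleR)
  have "l * ep * inverse r = c *\<^sub>R (l * w * em * inverse r)"
    unfolding ep by (simp add: mult.assoc)
  also have "\<dots> = (c * norm em) *\<^sub>R qi"
    unfolding l(2) using lem by (simp add: mult.assoc)
  finally have lep: "l * ep * inverse r = (c * norm em) *\<^sub>R qi" .
  have "l * (x *\<^sub>R ep + y *\<^sub>R em) * inverse r = x *\<^sub>R (l * ep * inverse r) + y *\<^sub>R (l * em * inverse r)" for x y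
    by (simp add: distrib_left distrib_right)
  then have coords: "qim2 (l * (x *\<^sub>R ep + y *\<^sub>R em) * inverse r) = 0"
      "qim3 (l * (x *\<^sub>R ep + y *\<^sub>R em) * inverse r) = 0" for x y
    unfolding lep lem by simp_all
  have half: "(1 / 2) *\<^sub>R q + (1 / 2) *\<^sub>R q = q" for q :: quat
    by (simp flip: scaleR_left_distrib)
  have g1_eq: "g1 = (1/2) *\<^sub>R ep + (1/2) *\<^sub>R em" and h_eq: "h = (1/2) *\<^sub>R ep + (- 1/2) *\<^sub>R em"
    using half by (simp_all add: ep_def em_def algebra_simps)
  have g2_eq: "g2 = (inverse \<alpha> * (norm \<xi> * norm \<eta>) / 2 - \<mu> / \<alpha> / 2) *\<^sub>R ep +
      (- inverse \<alpha> * (norm \<xi> * norm \<eta>) / 2 - \<mu> / \<alpha> / 2) *\<^sub>R em"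
    unfolding g2 \<xi>h by (subst h_eq, subst g1_eq) (simp add: algebra_simps)
  have "qim2 (l * g1 * inverse r) = 0 \<and> qim3 (l * g1 * inverse r) = 0 \<and>
      qim2 (l * g2 * inverse r) = 0 \<and> qim3 (l * g2 * inverse r) = 0"
    using coords g1_eq g2_eq by metis
  with l r l\<xi> r\<eta> show ?thesis by blast
qed

section \<open>Unit quaternions in the plane of \<open>1\<close> and \<open>qi\<close>\<close>

lemma complex_S3_eq_expi:
  assumes "q \<in> S3" "qim2 q = 0" "qim3 q = 0"
  shows "\<exists>\<beta>. q = expi \<beta>"
proof -
  have "(qre q)\<^sup>2 + (qim1 q)\<^sup>2 = 1"
    using S3_inner_self [OF assms(1)] assms(2,3) by (simp add: inner_quat_def power2_eq_square)
  then obtain \<beta> where "qre q = cos \<beta>" "qim1 q = sin \<beta>"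
    using sincos_total_2pi_le by metis
  with assms(2,3) show ?thesis by (intro exI [of _ \<beta>]) (simp add: quat_eq_iff)
qed

lemma inner_expi: "expi \<alpha> \<bullet> expi \<beta> = cos (\<beta> - \<alpha>)"
  by (simp add: inner_quat_def cos_diff mult.commute)

lemma conjugate_expi_j: "qj * expi \<alpha> * inverse qj = expi (- \<alpha>)"
  by (simp add: inverse_S3 quat_eq_iff)

lemma exists_mod_pi: "\<exists>n :: int. 0 \<le> x + of_int n * pi \<and> x + of_int n * pi < pi"
proof -
  have "of_int \<lfloor>x / pi\<rfloor> * pi \<le> x" "x < (of_int \<lfloor>x / pi\<rfloor> + 1) * pi"
    using floor_divide_lower [OF pi_gt_zero] floor_divide_upper [OF pi_gt_zero] by simp_all
  then show ?thesis by (intro exI [of _ "- \<lfloor>x / pi\<rfloor>"]) (simp add: algebra_simps)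
qed

text \<open>Moving the positions into the plane of \<open>1\<close> and \<open>qi\<close> fixes the
  difference of their arguments only up to sign and modulo full turns, and leaves a common sign
  free. A reflection settles the former; the latter brings \<open>\<phi>2\<close> into the half-open
  interval.\<close>

lemma balanced_pair_normal_form:
  fixes \<xi> \<eta> g1 g2 :: quat
  assumes im: "\<xi> \<in> ImH" "\<eta> \<in> ImH"
    and g: "g1 \<in> S3" "g2 \<in> S3" "0 < \<theta>" "\<theta> < pi" "\<theta> = subtended_angle g1 g2"
    and plane: "\<xi> * g1 * \<eta> = \<alpha> *\<^sub>R g2 + \<mu> *\<^sub>R g1" "\<alpha> \<noteq> 0"
  shows "\<exists>l\<in>S3. \<exists>r\<in>S3. \<exists>\<phi>1 \<phi>2. l * \<xi> = norm \<xi> *\<^sub>R qj * l \<and> r * \<eta> = norm \<eta> *\<^sub>R qj * r \<and>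
    l * g1 * inverse r = expi (- \<phi>1) \<and> l * g2 * inverse r = expi \<phi>2 \<and>
    \<phi>1 + \<phi>2 = \<theta> \<and> 0 \<le> \<phi>2 \<and> \<phi>2 < pi"
proof -
  have cos\<theta>: "g1 \<bullet> g2 = cos \<theta>"
    using cos_subtended_angle g by metis
  have ne: "g1 \<bullet> g2 \<noteq> 1" "g1 \<bullet> g2 \<noteq> - 1"
    unfolding cos\<theta> using g cos_inj_pi [of \<theta> 0] cos_inj_pi [of \<theta> pi] by auto
  obtain l r where l: "l \<in> S3" "r \<in> S3" "l * \<xi> = norm \<xi> *\<^sub>R qj * l" "r * \<eta> = norm \<eta> *\<^sub>R qj * r"
    and c: "qim2 (l * g1 * inverse r) = 0" "qim3 (l * g1 * inverse r) = 0"
      "qim2 (l * g2 * inverse r) = 0" "qim3 (l * g2 * inverse r) = 0"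
    using invariant_plane_normal_form [OF im g(1,2) ne plane] by blast
  have "l * g1 * inverse r \<in> S3" "l * g2 * inverse r \<in> S3"
    using l g by (simp_all add: norm_mult norm_inverse)
  then obtain \<alpha> \<beta> where \<alpha>: "l * g1 * inverse r = expi \<alpha>" and \<beta>: "l * g2 * inverse r = expi \<beta>"
    using complex_S3_eq_expi c by meson
  have cos: "cos (\<beta> - \<alpha>) = cos \<theta>"
    unfolding inner_expi [symmetric] \<alpha> [symmetric] \<beta> [symmetric] cos\<theta> [symmetric]
    using l by (simp add: inner_S3_mult norm_inverse)
  \<comment> \<open>conjugation by \<open>j\<close> reflects the plane of \<open>1\<close> and \<open>i\<close>\<close>
  have "\<exists>l\<in>S3. \<exists>r\<in>S3. \<exists>\<alpha> \<beta>. l * \<xi> = norm \<xi> *\<^sub>R qj * l \<and> r * \<eta> = norm \<eta> *\<^sub>R qj * r \<and>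
      l * g1 * inverse r = expi \<alpha> \<and> l * g2 * inverse r = expi \<beta> \<and>
      cos (\<beta> - \<alpha>) = cos \<theta> \<and> sin (\<beta> - \<alpha>) = sin \<theta>"
  proof (cases "sin (\<beta> - \<alpha>) = sin \<theta>")
    case True
    with l \<alpha> \<beta> cos show ?thesis by blast
  next
    case False
    have "(sin (\<beta> - \<alpha>))\<^sup>2 = (sin \<theta>)\<^sup>2" unfolding sin_squared_eq cos ..
    with False have "sin (- \<beta> - - \<alpha>) = sin \<theta>"
      by (metis power2_eq_iff minus_diff_minus sin_minus minus_minus)
    moreover have "cos (- \<beta> - - \<alpha>) = cos \<theta>"
      using cos by (metis minus_diff_minus cos_minus)
    moreover have "qj * l * g * inverse (qj * r) = qj * (l * g * inverse r) * inverse qj" for g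
      using l by (subst nonzero_inverse_mult_distrib) (auto simp: mult.assoc)
    then have "qj * l * g1 * inverse (qj * r) = expi (- \<alpha>)" "qj * l * g2 * inverse (qj * r) = expi (- \<beta>)"
      using conjugate_expi_j by (simp_all add: \<alpha> \<beta>)
    moreover have "qj * l * \<xi> = norm \<xi> *\<^sub>R qj * (qj * l)" "qj * r * \<eta> = norm \<eta> *\<^sub>R qj * (qj * r)"
      using l by (simp_all add: mult.assoc)
    moreover have "qj * l \<in> S3" "qj * r \<in> S3"
      using l by (simp_all add: norm_mult)
    ultimately show ?thesis by blast
  qed
  then obtain l r \<alpha> \<beta> where l: "l \<in> S3" "r \<in> S3" "l * \<xi> = norm \<xi> *\<^sub>R qj * l" "r * \<eta> = norm \<eta> *\<^sub>R qj * r"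
    and \<alpha>: "l * g1 * inverse r = expi \<alpha>" and \<beta>: "l * g2 * inverse r = expi \<beta>"
    and cos: "cos (\<beta> - \<alpha>) = cos \<theta>" and sin: "sin (\<beta> - \<alpha>) = sin \<theta>"
    by blast
  have \<alpha>': "expi \<alpha> = expi (\<beta> - \<theta>)"
    using cos_diff [of \<beta> "\<beta> - \<alpha>"] sin_diff [of \<beta> "\<beta> - \<alpha>"]
    by (simp add: quat_eq_iff cos_diff [of \<beta> \<theta>] sin_diff [of \<beta> \<theta>] cos sin)
  obtain n :: int where n: "0 \<le> \<beta> + of_int n * pi" "\<beta> + of_int n * pi < pi"
    using exists_mod_pi by blast
  define \<phi>2 where "\<phi>2 = \<beta> + of_int n * pi"
  define \<phi>1 where "\<phi>1 = \<theta> - \<phi>2"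
  have \<phi>: "- \<phi>1 = \<beta> - \<theta> + of_int n * pi" by (simp add: \<phi>1_def \<phi>2_def)
  have shift: "expi (x + of_int n * pi) = (if even n then 1 else - 1) * expi x" for x
    by (simp add: quat_eq_iff sin_add cos_add cos_npi_int sin_npi_int mult.commute [of _ pi])
  \<comment> \<open>Adding \<open>n * pi\<close> to both arguments multiplies both positions by the
    same sign, which is absorbed into \<open>l\<close>.\<close>
  define \<epsilon> :: quat where "\<epsilon> = (if even n then 1 else - 1)"
  have \<epsilon>: "\<epsilon> * l \<in> S3" "\<epsilon> * l * \<xi> = norm \<xi> *\<^sub>R qj * (\<epsilon> * l)"
    using l by (simp_all add: \<epsilon>_def)
  have "\<epsilon> * l * g1 * inverse r = expi (- \<phi>1)" "\<epsilon> * l * g2 * inverse r = expi \<phi>2"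
    unfolding \<phi> \<phi>2_def shift \<epsilon>_def [symmetric] \<alpha>' [symmetric] \<alpha> [symmetric] \<beta> [symmetric]
    by (simp_all add: mult.assoc)
  moreover have "\<phi>1 + \<phi>2 = \<theta>" "0 \<le> \<phi>2" "\<phi>2 < pi"
    using n by (simp_all add: \<phi>1_def \<phi>2_def)
  ultimately show ?thesis using \<epsilon> l(2,4) by blast
qed

section \<open>The balance equations in the plane of \<open>1\<close> and \<open>qi\<close>\<close>

lemma subtended_angle_expi:
  "subtended_angle (expi (- \<phi>1)) (expi \<phi>2) = \<phi>1 + \<phi>2" if "0 \<le> \<phi>1 + \<phi>2" "\<phi>1 + \<phi>2 \<le> pi"
  using that inner_expi [of "- \<phi>1" \<phi>2] by (simp add: subtended_angle_def add.commute arccos_cos)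

text \<open>Being a multiple of \<open>(c, - s)\<close> means being orthogonal to
  \<open>(s, c)\<close>; by unit length the factor is \<open>x * c - y * s\<close>. This eliminates
  the multipliers.\<close>

lemma proportional_to_unit_vector_iff:
  fixes x y c s :: real
  assumes "c\<^sup>2 + s\<^sup>2 = 1"
  shows "(\<exists>\<mu>. x = \<mu> * c \<and> y = - (\<mu> * s)) \<longleftrightarrow> x * s + y * c = 0"
proof
  assume *: "x * s + y * c = 0"
  have "x = (x * c - y * s) * c" "y = - ((x * c - y * s) * s)"
    using assms * by algebra+
  then show "\<exists>\<mu>. x = \<mu> * c \<and> y = - (\<mu> * s)" by blast
qed auto

context two_body
begin

text \<open>Multiplication by \<open>qj\<close> on both sides sends \<open>expi t\<close> to
  \<open>- expi (- t)\<close>, so the mixed term for \<open>g1\<close> points along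
  \<open>expi \<phi>1\<close>. Its component orthogonal to \<open>g1\<close> gives the double angle,
  that of the force gives \<open>\<kappa>\<close>; the second particle is symmetric.\<close>

lemma balanced_expi_iff:
  assumes \<theta>: "0 \<le> \<phi>1 + \<phi>2" "\<phi>1 + \<phi>2 \<le> pi"
  defines "\<kappa> \<equiv> f (\<phi>1 + \<phi>2) * sin (\<phi>1 + \<phi>2)"
  shows "balanced (a *\<^sub>R qj) (b *\<^sub>R qj) (expi (- \<phi>1)) (expi \<phi>2) \<longleftrightarrow>
    2 * a * b * (m1 * sin (2 * \<phi>1)) = \<kappa> \<and> 2 * a * b * (m2 * sin (2 * \<phi>2)) = \<kappa>"
proof -
  let ?F = "f (\<phi>1 + \<phi>2)"
  have "(\<exists>\<mu>. (- 2 * m1) *\<^sub>R (a *\<^sub>R qj * expi (- \<phi>1) * b *\<^sub>R qj) = ?F *\<^sub>R expi \<phi>2 + \<mu> *\<^sub>R expi (- \<phi>1)) \<longleftrightarrow>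
      (\<exists>\<mu>. 2 * a * b * m1 * cos \<phi>1 - ?F * cos \<phi>2 = \<mu> * cos \<phi>1 \<and>
        2 * a * b * m1 * sin \<phi>1 - ?F * sin \<phi>2 = - (\<mu> * sin \<phi>1))"
    by (intro ex_cong1) (auto simp: quat_eq_iff algebra_simps)
  also have "\<dots> \<longleftrightarrow> 2 * a * b * (m1 * sin (2 * \<phi>1)) = \<kappa>"
    unfolding sin_double \<kappa>_def by (subst proportional_to_unit_vector_iff)
      (auto simp: sin_add algebra_simps)
  finally have 1: "(\<exists>\<mu>. (- 2 * m1) *\<^sub>R (a *\<^sub>R qj * expi (- \<phi>1) * b *\<^sub>R qj) =
      ?F *\<^sub>R expi \<phi>2 + \<mu> *\<^sub>R expi (- \<phi>1)) \<longleftrightarrow> 2 * a * b * (m1 * sin (2 * \<phi>1)) = \<kappa>" .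
  have "(\<exists>\<mu>. (- 2 * m2) *\<^sub>R (a *\<^sub>R qj * expi \<phi>2 * b *\<^sub>R qj) = ?F *\<^sub>R expi (- \<phi>1) + \<mu> *\<^sub>R expi \<phi>2) \<longleftrightarrow>
      (\<exists>\<mu>. 2 * a * b * m2 * cos \<phi>2 - ?F * cos \<phi>1 = \<mu> * cos \<phi>2 \<and>
        2 * a * b * m2 * sin \<phi>2 - ?F * sin \<phi>1 = - (\<mu> * sin \<phi>2))"
    by (intro ex_cong1) (auto simp: quat_eq_iff algebra_simps)
  also have "\<dots> \<longleftrightarrow> 2 * a * b * (m2 * sin (2 * \<phi>2)) = \<kappa>"
    unfolding sin_double \<kappa>_def by (subst proportional_to_unit_vector_iff)
      (auto simp: sin_add algebra_simps)
  finally have 2: "(\<exists>\<mu>. (- 2 * m2) *\<^sub>R (a *\<^sub>R qj * expi \<phi>2 * b *\<^sub>R qj) =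
      ?F *\<^sub>R expi (- \<phi>1) + \<mu> *\<^sub>R expi \<phi>2) \<longleftrightarrow> 2 * a * b * (m2 * sin (2 * \<phi>2)) = \<kappa>" .
  show ?thesis
    unfolding balanced_def subtended_angle_expi [OF \<theta>] 1 [symmetric] 2 [symmetric] by blast
qed

text \<open>Force and sine are nonzero, so the balance equations force a nonzero
  \<open>\<zeta>\<close> and dividing by it loses nothing.\<close>

lemma relative_equilibrium_expi_iff:
  assumes \<theta>: "0 < \<phi>1 + \<phi>2" "\<phi>1 + \<phi>2 < pi" and f: "f (\<phi>1 + \<phi>2) \<noteq> 0"
  shows "relative_equilibrium \<Theta> m1 m2 V (a *\<^sub>R qj) (b *\<^sub>R qj)
      (standard_motion m1 m2 a b (expi (- \<phi>1)) (expi \<phi>2)) \<longleftrightarrow>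
    velocity_relation m1 m2 f (\<phi>1 + \<phi>2) \<phi>1 \<phi>2 a b"
proof -
  have "f (\<phi>1 + \<phi>2) * sin (\<phi>1 + \<phi>2) \<noteq> 0"
    using \<theta> f sin_gt_zero [of "\<phi>1 + \<phi>2"] by simp
  then have "(\<exists>\<zeta>. \<zeta> \<noteq> 0 \<and> \<zeta> = x \<and> \<zeta> = y \<and> 2 * a * b = f (\<phi>1 + \<phi>2) * sin (\<phi>1 + \<phi>2) / \<zeta>) \<longleftrightarrow>
      2 * a * b * x = f (\<phi>1 + \<phi>2) * sin (\<phi>1 + \<phi>2) \<and>
      2 * a * b * y = f (\<phi>1 + \<phi>2) * sin (\<phi>1 + \<phi>2)" for x y
    by (metis mult_cancel_left mult_zero_right mult_zero_left nonzero_eq_divide_eq)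
  then have "velocity_relation m1 m2 f (\<phi>1 + \<phi>2) \<phi>1 \<phi>2 a b \<longleftrightarrow>
      2 * a * b * (m1 * sin (2 * \<phi>1)) = f (\<phi>1 + \<phi>2) * sin (\<phi>1 + \<phi>2) \<and>
      2 * a * b * (m2 * sin (2 * \<phi>2)) = f (\<phi>1 + \<phi>2) * sin (\<phi>1 + \<phi>2)"
    unfolding velocity_relation_def by blast
  moreover have "subtended_angle (expi (- \<phi>1)) (expi \<phi>2) \<in> \<Theta>"
    using \<theta> angles by (subst subtended_angle_expi) auto
  ultimately show ?thesis
    using \<theta> relative_equilibrium_standard_motion_iff [of "expi (- \<phi>1)" "expi \<phi>2" a b]
      balanced_expi_iff [of \<phi>1 \<phi>2 a b] by simp
qed

end

section \<open>Angles and velocities\<close>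

text \<open>As \<open>2 * a * b\<close> is non-negative and the force term is nonzero,
  \<open>\<zeta>\<close> must have the sign of the force.\<close>

lemma exists_velocities_iff:
  assumes "0 < m2" "0 < sin \<theta>" "f \<theta> \<noteq> 0"
  shows "(\<exists>a\<ge>0. \<exists>b\<ge>0. velocity_relation m1 m2 f \<theta> \<phi>1 \<phi>2 a b) \<longleftrightarrow>
    m1 * sin (2 * \<phi>1) = m2 * sin (2 * \<phi>2) \<and> 0 < f \<theta> * sin (2 * \<phi>2)"
proof
  assume "\<exists>a\<ge>0. \<exists>b\<ge>0. velocity_relation m1 m2 f \<theta> \<phi>1 \<phi>2 a b"
  then obtain a b \<zeta> where ab: "0 \<le> a" "0 \<le> b" and \<zeta>: "\<zeta> \<noteq> 0" "\<zeta> = m1 * sin (2 * \<phi>1)" "\<zeta> = m2 * sin (2 * \<phi>2)"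
    and eq: "2 * a * b = f \<theta> * sin \<theta> / \<zeta>"
    unfolding velocity_relation_def by blast
  have "0 \<le> f \<theta> * sin \<theta> / \<zeta>"
    unfolding eq [symmetric] using ab by simp
  moreover have "f \<theta> * sin \<theta> / \<zeta> \<noteq> 0" using \<zeta>(1) assms by simp
  ultimately have "0 < f \<theta> * sin \<theta> / (m2 * sin (2 * \<phi>2))" unfolding \<zeta>(3) by linarith
  with assms have "0 < f \<theta> * sin (2 * \<phi>2)"
    by (auto simp: zero_less_divide_iff zero_less_mult_iff mult_less_0_iff)
  with \<zeta> show "m1 * sin (2 * \<phi>1) = m2 * sin (2 * \<phi>2) \<and> 0 < f \<theta> * sin (2 * \<phi>2)" by simp
next
  assume *: "m1 * sin (2 * \<phi>1) = m2 * sin (2 * \<phi>2) \<and> 0 < f \<theta> * sin (2 * \<phi>2)"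
  \<comment> \<open>Only the product of the velocities is prescribed, so \<open>a\<close> can be
    taken to be 1.\<close>
  define b where "b = f \<theta> * sin \<theta> / (m2 * sin (2 * \<phi>2)) / 2"
  have "0 \<le> b"
    using * assms by (auto simp: b_def zero_less_mult_iff zero_le_divide_iff mult_nonneg_nonneg mult_nonpos_nonneg)
      (auto simp: mult_le_0_iff zero_le_mult_iff)
  moreover have "velocity_relation m1 m2 f \<theta> \<phi>1 \<phi>2 1 b"
    unfolding velocity_relation_def b_def using * assms by auto
  ultimately show "\<exists>a\<ge>0. \<exists>b\<ge>0. velocity_relation m1 m2 f \<theta> \<phi>1 \<phi>2 a b"
    using zero_le_one by blast
qed

text \<open>With \<open>\<phi>1 = \<theta> - \<phi>2\<close>, the first equation determines the line through the origin spanned by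
  \<open>(cos 2\<phi>2, sin 2\<phi>2)\<close>, and the sign condition selects a half-line.\<close>

lemma acute_obtuse_angles_unique:
  fixes m1 m2 F \<theta> :: real
  assumes m: "m1 \<noteq> 0" and \<theta>: "0 < \<theta>" "\<theta> < pi" "\<theta> \<noteq> pi / 2" and F: "F \<noteq> 0"
  shows "\<exists>!\<phi>2. 0 \<le> \<phi>2 \<and> \<phi>2 \<le> pi \<and> m1 * sin (2 * (\<theta> - \<phi>2)) = m2 * sin (2 * \<phi>2) \<and> 0 < F * sin (2 * \<phi>2)"
proof -
  define A where "A = m1 * sin (2 * \<theta>)"
  define B where "B = m2 + m1 * cos (2 * \<theta>)"
  have eq_iff: "m1 * sin (2 * (\<theta> - \<phi>2)) = m2 * sin (2 * \<phi>2) \<longleftrightarrow> A * cos (2 * \<phi>2) = B * sin (2 * \<phi>2)" for \<phi>2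
    by (simp add: A_def B_def right_diff_distrib sin_diff algebra_simps)
  \<comment> \<open>The excluded right angle is needed here: it keeps \<open>2 * \<theta>\<close>
    away from the multiples of \<open>pi\<close>.\<close>
  have A: "A \<noteq> 0"
    using m \<theta> sin_zero_pi_iff [of "2 * \<theta> - pi"] by (auto simp: A_def)
  \<comment> \<open>The solutions lie on the line spanned by \<open>(B, A)\<close>;
    \<open>\<sigma>\<close> orients it so that the second coordinate has the sign of
    \<open>F\<close>.\<close>
  define \<sigma> where "\<sigma> = sgn (F * A)"
  have \<sigma>: "\<sigma> \<noteq> 0" "0 < F * (\<sigma> * A)"
    using A F by (auto simp: \<sigma>_def sgn_real_def zero_less_mult_iff mult_less_0_iff not_less)
  define \<rho> where "\<rho> = sqrt ((\<sigma> * B)\<^sup>2 + (\<sigma> * A)\<^sup>2)"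
  have \<rho>: "0 < \<rho>" "\<rho>\<^sup>2 = (\<sigma> * B)\<^sup>2 + (\<sigma> * A)\<^sup>2"
    using A \<sigma> by (simp_all add: \<rho>_def add_nonneg_pos)
  have "(\<sigma> * B / \<rho>)\<^sup>2 + (\<sigma> * A / \<rho>)\<^sup>2 = 1"
    unfolding power_divide add_divide_distrib [symmetric] \<rho>(2) [symmetric] using \<rho>(1) by simp
  then obtain \<psi> where \<psi>: "0 \<le> \<psi>" "\<psi> \<le> 2 * pi" "\<sigma> * B / \<rho> = cos \<psi>" "\<sigma> * A / \<rho> = sin \<psi>"
    using sincos_total_2pi_le by metis
  show ?thesis
  proof (rule ex1I [of _ "\<psi> / 2"])
    have "F * sin \<psi> = F * (\<sigma> * A) / \<rho>" by (simp add: \<psi>(4) [symmetric])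
    then have "0 < F * sin \<psi>" using \<sigma> \<rho> by simp
    moreover have "A * cos \<psi> = B * sin \<psi>" by (simp add: \<psi>(3,4) [symmetric])
    ultimately show "0 \<le> \<psi> / 2 \<and> \<psi> / 2 \<le> pi \<and> m1 * sin (2 * (\<theta> - \<psi> / 2)) = m2 * sin (2 * (\<psi> / 2)) \<and>
        0 < F * sin (2 * (\<psi> / 2))"
      unfolding eq_iff using \<psi> by simp
    fix \<phi>2
    assume *: "0 \<le> \<phi>2 \<and> \<phi>2 \<le> pi \<and> m1 * sin (2 * (\<theta> - \<phi>2)) = m2 * sin (2 * \<phi>2) \<and> 0 < F * sin (2 * \<phi>2)"
    then have eq: "A * cos (2 * \<phi>2) = B * sin (2 * \<phi>2)" unfolding eq_iff by simp
    have "A * sin (2 * \<phi>2 - \<psi>) = sin (2 * \<phi>2) * (A * cos \<psi>) - (A * cos (2 * \<phi>2)) * sin \<psi>"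
      by (simp add: sin_diff algebra_simps)
    also have "\<dots> = 0" unfolding eq \<open>A * cos \<psi> = B * sin \<psi>\<close> by simp
    finally have sin0: "sin (2 * \<phi>2 - \<psi>) = 0" using A by simp
    have half: "0 < x \<and> x < pi \<or> pi < x \<and> x < 2 * pi" if "0 \<le> x" "x \<le> 2 * pi" "sin x \<noteq> 0" for x :: real
      using that by (smt (verit) sin_zero sin_pi sin_two_pi)
    \<comment> \<open>Equal signs of the sines put both angles into the same open half of the
      circle, so they differ by less than \<open>pi\<close>, and the vanishing sine of the
      difference makes them equal.\<close>
    have "sin (2 * \<phi>2) * sin \<psi> > 0"
      using * \<open>0 < F * sin \<psi>\<close> by (auto simp: zero_less_mult_iff)
    moreover have "sin x > 0" if "0 < x" "x < pi" for x :: real using that by (rule sin_gt_zero)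
    moreover have "sin x < 0" if "pi < x" "x < 2 * pi" for x :: real using that by (rule sin_lt_zero)
    ultimately have "- pi < 2 * \<phi>2 - \<psi>" "2 * \<phi>2 - \<psi> < pi"
      using half [of "2 * \<phi>2"] half [of \<psi>] * \<psi>(1,2)
      by (smt (verit) mult_pos_neg mult_neg_pos mult_eq_0_iff)+
    from sin_eq_0_pi [OF this sin0] show "\<phi>2 = \<psi> / 2" by simp
  qed
qed

section \<open>Distinct standard motions are not conjugate\<close>

text \<open>The velocity field \<open>q \<mapsto> a j q - b q j\<close> stretches the plane of \<open>1\<close> and \<open>i\<close> by \<open>\<bar>a - b\<bar>\<close> along
  the first and by \<open>a + b\<close> along the second axis, so a conjugation preserves the two axes.\<close>

lemma conjugate_standard_motion_unique:
  assumes m: "0 < m1" "0 < m2"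
    and ab: "0 < a" "0 < b" "0 < a'" "0 < b'"
    and \<phi>: "0 < \<phi>2" "\<phi>2 < pi" "0 < \<phi>1 + \<phi>2" "\<phi>1 + \<phi>2 < pi"
    and \<phi>': "0 < \<phi>2'" "\<phi>2' < pi" "0 < \<phi>1' + \<phi>2'" "\<phi>1' + \<phi>2' < pi"
    and conj: "conjugate (standard_motion m1 m2 a b (expi (- \<phi>1)) (expi \<phi>2))
      (standard_motion m1 m2 a' b' (expi (- \<phi>1')) (expi \<phi>2'))"
  shows "a = a' \<and> b = b' \<and> \<phi>1 = \<phi>1' \<and> \<phi>2 = \<phi>2'"
proof -
  define T where "T q = a *\<^sub>R qj * q - q * b *\<^sub>R qj" for q
  define T' where "T' q = a' *\<^sub>R qj * q - q * b' *\<^sub>R qj" for q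
  \<comment> \<open>Time 0 suffices: the initial positions and momenta determine all
    parameters.\<close>
  obtain l r where l: "l \<in> S3" "r \<in> S3"
    and *: "standard_motion m1 m2 a' b' (expi (- \<phi>1')) (expi \<phi>2') 0 =
      act l r (standard_motion m1 m2 a b (expi (- \<phi>1)) (expi \<phi>2) 0)"
    using conj unfolding conjugate_def by blast
  define s where "s = inverse r"
  have s: "s \<in> S3" using l by (simp add: s_def norm_inverse)
  have nz: "l \<noteq> 0" "s \<noteq> 0" using l s by auto
  define L where "L q = l * q * s" for q
  have L_lin: "L (c *\<^sub>R p + d *\<^sub>R q) = c *\<^sub>R L p + d *\<^sub>R L q" for c d p q
    by (simp add: L_def distrib_left distrib_right)
  have T_lin: "T (c *\<^sub>R p + d *\<^sub>R q) = c *\<^sub>R T p + d *\<^sub>R T q"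
    "T' (c *\<^sub>R p + d *\<^sub>R q) = c *\<^sub>R T' p + d *\<^sub>R T' q" for c d p q
    by (simp_all add: T_def T'_def algebra_simps)
  have L_inner: "L p \<bullet> L q = p \<bullet> q" for p q
    unfolding L_def by (rule inner_S3_mult [OF l(1) s])
  have initial: "expi (- \<phi>1') = L (expi (- \<phi>1)) \<and> m1 *\<^sub>R T' (expi (- \<phi>1')) = L (m1 *\<^sub>R T (expi (- \<phi>1))) \<and>
      expi \<phi>2' = L (expi \<phi>2) \<and> m2 *\<^sub>R T' (expi \<phi>2') = L (m2 *\<^sub>R T (expi \<phi>2))"
    using * unfolding standard_motion_0 act_def split_conv prod.inject L_def T_def T'_def s_def .
  then have Lg: "L (expi (- \<phi>1)) = expi (- \<phi>1')" "L (expi \<phi>2) = expi \<phi>2'" by metis+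
  have "T' p = L (T q)" if "m *\<^sub>R T' p = L (m *\<^sub>R T q)" "0 < m" for m p q
    using that by (simp add: L_def)
  with m initial have LT: "T' (L (expi (- \<phi>1))) = L (T (expi (- \<phi>1)))" "T' (L (expi \<phi>2)) = L (T (expi \<phi>2))"
    unfolding Lg by blast+
  let ?\<theta> = "\<phi>1 + \<phi>2"
  have sin\<theta>: "0 < sin ?\<theta>" "0 < sin (\<phi>1' + \<phi>2')"
    using \<phi> \<phi>' sin_gt_zero by simp_all
  \<comment> \<open>As \<open>sin ?\<theta>\<close> is nonzero, the two positions span the plane of
    \<open>1\<close> and \<open>qi\<close>, so the relations for \<open>L\<close> and the velocity
    fields extend to this basis.\<close>
  have one: "1 = (sin \<phi>2 / sin ?\<theta>) *\<^sub>R expi (- \<phi>1) + (sin \<phi>1 / sin ?\<theta>) *\<^sub>R expi \<phi>2"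
    and i: "qi = (- cos \<phi>2 / sin ?\<theta>) *\<^sub>R expi (- \<phi>1) + (cos \<phi>1 / sin ?\<theta>) *\<^sub>R expi \<phi>2"
    using sin\<theta>(1) by (simp_all add: quat_eq_iff field_simps) (simp_all add: sin_add algebra_simps)
  have LT1: "T' (L 1) = L (T 1)"
    by (subst (1 2) one) (simp only: L_lin T_lin LT)
  have LTi: "T' (L qi) = L (T qi)"
    by (subst (1 2) i) (simp only: L_lin T_lin LT)
  have "L 1 = (sin \<phi>2 / sin ?\<theta>) *\<^sub>R expi (- \<phi>1') + (sin \<phi>1 / sin ?\<theta>) *\<^sub>R expi \<phi>2'"
    by (subst one) (simp only: L_lin Lg)
  then have im1: "qim2 (L 1) = 0" "qim3 (L 1) = 0" by simp_all
  have "L qi = (- cos \<phi>2 / sin ?\<theta>) *\<^sub>R expi (- \<phi>1') + (cos \<phi>1 / sin ?\<theta>) *\<^sub>R expi \<phi>2'"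
    by (subst i) (simp only: L_lin Lg)
  then have imi: "qim2 (L qi) = 0" "qim3 (L qi) = 0" by simp_all
  define x y z w where "x = qre (L 1)" and "y = qim1 (L 1)" and "z = qre (L qi)" and "w = qim1 (L qi)"
  have L1: "L 1 = x *\<^sub>R 1 + y *\<^sub>R qi"
    by (simp add: quat_eq_iff im1 x_def y_def)
  have Li: "L qi = z *\<^sub>R 1 + w *\<^sub>R qi"
    by (simp add: quat_eq_iff imi z_def w_def)
  have xyzw: "x\<^sup>2 + y\<^sup>2 = 1" "z\<^sup>2 + w\<^sup>2 = 1" "x * z + y * w = 0"
    using L_inner [of 1 1] L_inner [of qi qi] L_inner [of 1 qi]
    by (simp_all add: L1 Li inner_quat_def power2_eq_square)
  have T1: "T 1 = (a - b) *\<^sub>R qj" and Ti: "T qi = (- (a + b)) *\<^sub>R qk"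
    by (simp_all add: T_def quat_eq_iff)
  have T'1: "T' (L 1) = ((a' - b') * x) *\<^sub>R qj + (- ((a' + b') * y)) *\<^sub>R qk"
    and T'i: "T' (L qi) = ((a' - b') * z) *\<^sub>R qj + (- ((a' + b') * w)) *\<^sub>R qk"
    unfolding L1 Li by (simp_all add: T'_def quat_eq_iff algebra_simps)
  \<comment> \<open>The isometry \<open>L\<close> preserves the two orthogonal velocities
    \<open>T 1\<close> and \<open>T qi\<close>, of lengths \<open>\<bar>a - b\<bar>\<close> and
    \<open>a + b\<close>; comparing inner products gives three relations.\<close>
  have n1: "((a' - b') * x)\<^sup>2 + ((a' + b') * y)\<^sup>2 = (a - b)\<^sup>2"
    using L_inner [of "T 1" "T 1"] unfolding LT1 [symmetric] T'1 unfolding T1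
    by (simp add: inner_quat_def power2_eq_square)
  have n2: "((a' - b') * z)\<^sup>2 + ((a' + b') * w)\<^sup>2 = (a + b)\<^sup>2"
    using L_inner [of "T qi" "T qi"] unfolding LTi [symmetric] T'i unfolding Ti
    by (simp add: inner_quat_def power2_eq_square algebra_simps)
  have n3: "(a' - b')\<^sup>2 * (x * z) + (a' + b')\<^sup>2 * (y * w) = 0"
    using L_inner [of "T 1" "T qi"] unfolding LT1 [symmetric] LTi [symmetric] T'1 T'i unfolding T1 Ti
    by (simp add: inner_quat_def power2_eq_square algebra_simps)
  have "4 * a' * b' * (y * w) = 0"
    using n3 xyzw(3) by algebra
  then have yw: "y = 0 \<or> w = 0" using ab by simp
  have w0: "w \<noteq> 0"
  proof
    \<comment> \<open>Here \<open>L\<close> would exchange the two axes, so the stretching factors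
      would be exchanged as well, forcing \<open>a' * b'\<close> to be
      \<open>- (a * b)\<close>.\<close>
    assume w: "w = 0"
    with xyzw have "z\<^sup>2 = 1" "x = 0" "y\<^sup>2 = 1" by auto
    with n1 n2 w have "(a' + b')\<^sup>2 = (a - b)\<^sup>2" "(a' - b')\<^sup>2 = (a + b)\<^sup>2"
      by (simp_all add: power_mult_distrib)
    then have "a' * b' + a * b = 0" by algebra
    with ab show False by (simp add: add_pos_pos less_imp_neq [THEN not_sym])
  qed
  with yw have y: "y = 0" by simp
  with xyzw have x: "x\<^sup>2 = 1" by simp
  with xyzw(3) y have z: "z = 0" by auto
  with xyzw have w: "w\<^sup>2 = 1" by simp
  have "(a' + b')\<^sup>2 = (a + b)\<^sup>2" using n2 z w by (simp add: power_mult_distrib)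
  then have sum: "a' + b' = a + b" using ab by (simp add: power2_eq_iff_nonneg)
  have Lc: "L (c *\<^sub>R 1 + d *\<^sub>R qi) = (c * x) *\<^sub>R 1 + (d * w) *\<^sub>R qi" for c d
    unfolding L_lin L1 Li y z by simp
  have expi: "expi t = cos t *\<^sub>R 1 + sin t *\<^sub>R qi" for t by (simp add: quat_eq_iff)
  have trig: "cos \<phi>1' = cos \<phi>1 * x" "sin \<phi>1' = sin \<phi>1 * w" "cos \<phi>2' = cos \<phi>2 * x" "sin \<phi>2' = sin \<phi>2 * w"
    using Lg unfolding expi Lc by (simp_all add: quat_eq_iff)
  have "sin (\<phi>1' + \<phi>2') = sin ?\<theta> * (x * w)"
    by (simp add: sin_add trig algebra_simps)
  \<comment> \<open>Both angles between the particles are oriented positively, which rules out a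
    reflection of the plane.\<close>
  with sin\<theta> have "0 < x * w" by (simp add: zero_less_mult_iff)
  with x w have wx: "w = x" by (auto simp: power2_eq_1_iff)
  have "cos (\<phi>1' + \<phi>2') = cos ?\<theta> * x\<^sup>2"
    by (simp add: cos_add trig wx algebra_simps power2_eq_square)
  then have \<theta>: "\<phi>1' + \<phi>2' = ?\<theta>"
    using x \<phi> \<phi>' cos_inj_pi by simp
  have "sin (\<phi>2' - \<phi>2) = 0" by (simp add: sin_diff trig wx)
  then have \<phi>2: "\<phi>2' = \<phi>2"
    using sin_eq_0_pi [of "\<phi>2' - \<phi>2"] \<phi> \<phi>' by simp
  \<comment> \<open>The lengths determine \<open>a - b\<close> only up to sign. To recover the sign,
    \<open>l\<close> is shown to commute with \<open>qi\<close> and \<open>qk\<close>, hence with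
    \<open>qj\<close>, so that \<open>L (T 1)\<close> is known as a vector.\<close>
  have ls: "l * s = x *\<^sub>R 1" and lis: "l * qi * s = x *\<^sub>R qi"
    using L1 Li y z wx by (simp_all add: L_def)
  have commute_iff: "l * q * s = x *\<^sub>R q \<longleftrightarrow> l * q = q * l" for q
  proof -
    have "x *\<^sub>R q = q * l * s" by (simp add: mult.assoc ls)
    then show ?thesis using nz by simp
  qed
  have "L (T qi) = (- (a + b)) *\<^sub>R (l * qk * s)" by (simp add: L_def Ti)
  moreover have "T' (L qi) = (- (a + b)) *\<^sub>R (x *\<^sub>R qk)"
    unfolding T'i z wx sum by (simp only: scaleR_scaleR mult_zero_right scaleR_zero_left add_0 mult_minus_left)
  ultimately have "(- (a + b)) *\<^sub>R (l * qk * s) = (- (a + b)) *\<^sub>R (x *\<^sub>R qk)"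
    using LTi by metis
  then have "l * qk * s = x *\<^sub>R qk"
    unfolding scaleR_cancel_left using ab by auto
  then have k: "l * qk = qk * l" and i: "l * qi = qi * l"
    using lis commute_iff by simp_all
  have "l * qj = l * qk * qi" by (simp add: mult.assoc quat_unit_rules)
  also have "\<dots> = qk * (l * qi)" by (simp add: k mult.assoc)
  also have "\<dots> = qj * l" by (simp add: i quat_unit_rules mult.assoc [symmetric])
  finally have "l * qj * s = x *\<^sub>R qj" unfolding commute_iff .
  then have "L (T 1) = ((a - b) * x) *\<^sub>R qj" by (simp add: L_def T1)
  moreover have "T' (L 1) = ((a' - b') * x) *\<^sub>R qj" by (simp add: T'1 y)
  ultimately have "a - b = a' - b'" using LT1 x by auto
  with sum \<theta> \<phi>2 show ?thesis by simp
qed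

section \<open>The classification\<close>

text \<open>The positions are central, so the left and right rotations about the same axis merge
  into one with angular velocity \<open>a - b\<close>.\<close>

lemma standard_motion_pm1_cong:
  assumes "a - b = a' - b'" "\<sigma> = 1 \<or> \<sigma> = - 1"
  shows "standard_motion m1 m2 a b 1 \<sigma> = standard_motion m1 m2 a' b' 1 \<sigma>"
proof -
  have 1: "j_motion a b 1 t = exp ((t * (a - b)) *\<^sub>R qj)" for a b t
  proof -
    have "j_motion a b 1 t = exp ((t * a) *\<^sub>R qj + - ((t * b) *\<^sub>R qj))"
      unfolding j_motion_def by (subst exp_add_commuting) simp_all
    then show ?thesis by (simp add: algebra_simps)
  qed
  then have "j_motion a b 1 = j_motion a' b' 1" using assms by (simp add: fun_eq_iff)
  moreover have "j_motion a b (- 1) = (\<lambda>t. - j_motion a b 1 t)" for a b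
    by (simp add: j_motion_def fun_eq_iff)
  ultimately have "j_motion a b 1 = j_motion a' b' 1" "j_motion a b \<sigma> = j_motion a' b' \<sigma>"
    using assms(2) by auto
  then show ?thesis by (intro ext) (simp only: standard_motion_def)
qed

section \<open>Reduction of singular and non-singular relative equilibria to standard
  motions\<close>

context two_body
begin

text \<open>Moving \<open>\<eta>\<close> to the left of \<open>g1\<close> turns it into
  \<open>\<zeta>\<close>, and the balance equation says that \<open>\<xi> * \<zeta>\<close> is real.
  The two imaginary quaternions are then parallel, so one \<open>l\<close> takes both to the
  \<open>qj\<close> axis, and \<open>r = l * g1\<close> takes \<open>g1\<close> to 1.\<close>

lemma singular_classification:
  assumes re: "relative_equilibrium \<Theta> m1 m2 V \<xi> \<eta> x"
    and x0: "x 0 = (g1, p1, \<sigma> * g1, p2)" and \<sigma>: "\<sigma> = 1 \<or> \<sigma> = - 1"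
  shows "\<exists>a\<ge>0. \<exists>b\<ge>0. conjugate x (standard_motion m1 m2 a b 1 \<sigma>)"
proof -
  let ?F = "f (subtended_angle g1 (\<sigma> * g1))"
  have im: "\<xi> \<in> ImH" "\<eta> \<in> ImH" and "x 0 \<in> phase_space \<Theta>"
    using re unfolding relative_equilibrium_def hamiltonian_solution_def by blast+
  then have g1: "g1 \<in> S3" by (simp add: x0 phase_space_def)
  then have g1_nz: "g1 \<noteq> 0" by auto
  define \<zeta> where "\<zeta> = g1 * \<eta> * inverse g1"
  have \<zeta>g: "\<zeta> * g1 = g1 * \<eta>" using g1_nz by (simp add: \<zeta>_def mult.assoc)
  have \<zeta>: "\<zeta> \<in> ImH" using im g1 by (simp add: \<zeta>_def inverse_S3 algebra_simps)
  obtain \<mu> where "(- 2 * m1) *\<^sub>R (\<xi> * g1 * \<eta>) = ?F *\<^sub>R (\<sigma> * g1) + \<mu> *\<^sub>R g1"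
    using relative_equilibrium_imp_balanced(3) [OF re x0] unfolding balanced_def by blast
  also have "\<dots> = (if \<sigma> = 1 then ?F + \<mu> else \<mu> - ?F) *\<^sub>R g1"
    using \<sigma> by (auto simp: algebra_simps)
  finally obtain \<nu> where "(- 2 * m1) *\<^sub>R (\<xi> * g1 * \<eta>) = \<nu> *\<^sub>R g1" by blast
  then have "(- 2 * m1) *\<^sub>R (\<xi> * \<zeta> * g1) = \<nu> *\<^sub>R g1"
    by (simp add: mult.assoc \<zeta>g)
  then have "((- 2 * m1) *\<^sub>R (\<xi> * \<zeta>) - \<nu> *\<^sub>R 1) * g1 = 0" by (simp add: algebra_simps)
  with g1_nz have "(- 2 * m1) *\<^sub>R (\<xi> * \<zeta>) = \<nu> *\<^sub>R 1" by simp
  \<comment> \<open>Another factor \<open>\<zeta>\<close> turns \<open>\<zeta> * \<zeta>\<close>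
    into a scalar and exhibits a multiple of \<open>\<xi>\<close> as a multiple of
    \<open>\<zeta>\<close>.\<close>
  then have "(- 2 * m1) *\<^sub>R (\<xi> * \<zeta>) * \<zeta> = \<nu> *\<^sub>R \<zeta>" by simp
  then have \<xi>: "(2 * m1 * (norm \<zeta>)\<^sup>2) *\<^sub>R \<xi> = \<nu> *\<^sub>R \<zeta>"
    using \<zeta> by (simp add: mult.assoc quat_im_square)
  have "\<exists>l\<in>S3. \<exists>a b. l * \<xi> = a *\<^sub>R qj * l \<and> l * \<zeta> = b *\<^sub>R qj * l"
  proof (cases "\<zeta> = 0")
    case True
    then have \<zeta>0: "l * \<zeta> = 0 *\<^sub>R qj * l" for l by simp
    obtain l where "l \<in> S3" "l * \<xi> = norm \<xi> *\<^sub>R qj * l"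
      using im_intertwines_j [OF im(1)] by blast
    with \<zeta>0 [of l] show ?thesis by blast
  next
    case False
    define c where "c = 2 * m1 * (norm \<zeta>)\<^sup>2"
    have "c \<noteq> 0" using False masses by (simp add: c_def)
    then have "\<xi> = inverse c *\<^sub>R (c *\<^sub>R \<xi>)" by simp
    also have "\<dots> = (inverse c * \<nu>) *\<^sub>R \<zeta>" unfolding c_def \<xi> by simp
    finally obtain \<kappa> where \<xi>\<zeta>: "\<xi> = \<kappa> *\<^sub>R \<zeta>" by blast
    obtain l where l: "l \<in> S3" "l * \<zeta> = norm \<zeta> *\<^sub>R qj * l"
      using im_intertwines_j [OF \<zeta>] by blast
    have "l * \<xi> = (\<kappa> * norm \<zeta>) *\<^sub>R qj * l" using l(2) by (simp add: \<xi>\<zeta>)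
    with l show ?thesis by blast
  qed
  then obtain l a b where l: "l \<in> S3" "l * \<xi> = a *\<^sub>R qj * l" "l * \<zeta> = b *\<^sub>R qj * l" by blast
  have r: "l * g1 \<in> S3" "l * g1 * \<eta> = b *\<^sub>R qj * (l * g1)"
    using l g1 by (simp_all add: norm_mult mult.assoc flip: \<zeta>g) (simp add: mult.assoc [symmetric])
  have "l * g1 \<noteq> 0" using r by auto
  then have "l * g1 * inverse (l * g1) = 1" "l * (\<sigma> * g1) * inverse (l * g1) = \<sigma>"
    using \<sigma> by (auto simp: right_inverse)
  with conjugate_standard_motionI [OF re x0 l(1) r(1) l(2) r(2)]
  have "conjugate x (standard_motion m1 m2 a b 1 \<sigma>)" by simp
  \<comment> \<open>The signs of \<open>a\<close> and \<open>b\<close> are uncontrolled, but only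
    their difference matters, so its positive and negative parts can replace them.\<close>
  also have "standard_motion m1 m2 a b 1 \<sigma> = standard_motion m1 m2 (max (a - b) 0) (max (b - a) 0) 1 \<sigma>"
    by (rule standard_motion_pm1_cong [OF _ \<sigma>]) auto
  finally show ?thesis by (meson max.cobounded2)
qed

lemma nonsingular_classification:
  assumes re: "relative_equilibrium \<Theta> m1 m2 V \<xi> \<eta> x" and \<theta>: "\<theta> = phase_angle (x 0)" "0 < \<theta>" "\<theta> < pi"
    and f: "f \<theta> \<noteq> 0"
  shows "\<exists>\<phi>1 \<phi>2. \<phi>1 + \<phi>2 = \<theta> \<and> 0 \<le> \<phi>2 \<and> \<phi>2 < pi \<and>
    velocity_relation m1 m2 f \<theta> \<phi>1 \<phi>2 (norm \<xi>) (norm \<eta>) \<and>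
    conjugate x (standard_motion m1 m2 (norm \<xi>) (norm \<eta>) (expi (- \<phi>1)) (expi \<phi>2))"
proof -
  obtain g1 p1 g2 p2 where x0: "x 0 = (g1, p1, g2, p2)" using prod_cases4 by blast
  have im: "\<xi> \<in> ImH" "\<eta> \<in> ImH" and "x 0 \<in> phase_space \<Theta>"
    using re unfolding relative_equilibrium_def hamiltonian_solution_def by blast+
  then have g: "g1 \<in> S3" "g2 \<in> S3" by (simp_all add: x0 phase_space_def)
  have \<theta>_eq: "\<theta> = subtended_angle g1 g2" using \<theta> by (simp add: x0 phase_angle_def)
  note bal = relative_equilibrium_imp_balanced(3) [OF re x0]
  then obtain \<mu> where \<mu>: "(- 2 * m1) *\<^sub>R (\<xi> * g1 * \<eta>) = f \<theta> *\<^sub>R g2 + \<mu> *\<^sub>R g1"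
    unfolding balanced_def \<theta>_eq by blast
  have "\<xi> * g1 * \<eta> = inverse (- 2 * m1) *\<^sub>R ((- 2 * m1) *\<^sub>R (\<xi> * g1 * \<eta>))"
    using masses by simp
  also have "\<dots> = (inverse (- 2 * m1) * f \<theta>) *\<^sub>R g2 + (inverse (- 2 * m1) * \<mu>) *\<^sub>R g1"
    unfolding \<mu> by (simp only: scaleR_add_right scaleR_scaleR)
  finally have plane: "\<xi> * g1 * \<eta> = (inverse (- 2 * m1) * f \<theta>) *\<^sub>R g2 + (inverse (- 2 * m1) * \<mu>) *\<^sub>R g1" .
  \<comment> \<open>The nonzero force makes the mixed term leave the line of \<open>g1\<close>, as
    the normal form requires.\<close>
  have "inverse (- 2 * m1) * f \<theta> \<noteq> 0" using f masses by simp
  from balanced_pair_normal_form [OF im g \<theta>(2,3) \<theta>_eq plane this]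
  obtain l r \<phi>1 \<phi>2 where l: "l \<in> S3" "r \<in> S3" "l * \<xi> = norm \<xi> *\<^sub>R qj * l" "r * \<eta> = norm \<eta> *\<^sub>R qj * r"
    and g': "l * g1 * inverse r = expi (- \<phi>1)" "l * g2 * inverse r = expi \<phi>2"
    and \<phi>: "\<phi>1 + \<phi>2 = \<theta>" "0 \<le> \<phi>2" "\<phi>2 < pi"
    by blast
  have conj: "conjugate x (standard_motion m1 m2 (norm \<xi>) (norm \<eta>) (expi (- \<phi>1)) (expi \<phi>2))"
    using conjugate_standard_motionI [OF re x0 l] unfolding g' .
  have "balanced (norm \<xi> *\<^sub>R qj) (norm \<eta> *\<^sub>R qj) (expi (- \<phi>1)) (expi \<phi>2)"
    using balanced_act [OF l bal] unfolding g' .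
  moreover have "subtended_angle (expi (- \<phi>1)) (expi \<phi>2) \<in> \<Theta>"
    using \<theta> \<phi> angles by (subst subtended_angle_expi) auto
  ultimately have "velocity_relation m1 m2 f (\<phi>1 + \<phi>2) \<phi>1 \<phi>2 (norm \<xi>) (norm \<eta>)"
    using relative_equilibrium_standard_motion_iff [of "expi (- \<phi>1)" "expi \<phi>2"]
      relative_equilibrium_expi_iff [of \<phi>1 \<phi>2] \<theta> \<phi>(1) f by simp
  with conj \<phi> show ?thesis by blast
qed

lemma relative_equilibrium_pm1:
  assumes "\<sigma> = 1 \<or> \<sigma> = - 1" "subtended_angle 1 \<sigma> \<in> \<Theta>"
  shows "relative_equilibrium \<Theta> m1 m2 V (a *\<^sub>R qj) (b *\<^sub>R qj) (standard_motion m1 m2 a b 1 \<sigma>)"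
proof -
  let ?F = "f (subtended_angle 1 \<sigma>)"
  have "balanced (a *\<^sub>R qj) (b *\<^sub>R qj) 1 \<sigma>"
    unfolding balanced_def using assms(1)
    \<comment> \<open>All terms are real multiples of 1, so the equations can be solved for the
      multipliers; \<open>qre \<sigma>\<close> is the sign of \<open>\<sigma>\<close> as a real
      number.\<close>
    by (intro exI [of _ "2 * m1 * a * b - qre \<sigma> * ?F"] exI [of _ "2 * m2 * a * b - qre \<sigma> * ?F"])
      (auto simp: quat_eq_iff)
  then show ?thesis
    using assms by (subst relative_equilibrium_standard_motion_iff) auto
qed

end

theorem theorem3p1:
  fixes m1 m2 :: real
    and \<Theta> :: "real set"
    and V :: "quat \<Rightarrow> quat \<Rightarrow> real"
    and f :: "real \<Rightarrow> real"
  assumes "0 < m1" "0 < m2"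
    and "{0<..<pi} \<subseteq> \<Theta>" "\<Theta> \<subseteq> {0..pi}"
    and "distance_potential \<Theta> V" "has_force \<Theta> V f"
    and "strictly_attractive \<Theta> f \<or> strictly_repulsive \<Theta> f"
  shows
    \<comment> \<open>every relative equilibrium is conjugate to one in the list\<close>
    "(\<forall>\<xi> \<eta> x \<theta>. relative_equilibrium \<Theta> m1 m2 V \<xi> \<eta> x \<and> \<theta> = phase_angle (x 0) \<longrightarrow>
       (\<theta> = 0 \<longrightarrow>
         (\<exists>a\<ge>0. \<exists>b\<ge>0. conjugate x (standard_motion m1 m2 a b 1 1))) \<and>
       (\<theta> = pi \<longrightarrow>
         (\<exists>a\<ge>0. \<exists>b\<ge>0. conjugate x (standard_motion m1 m2 a b 1 (- 1)))) \<and>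
       (0 < \<theta> \<and> \<theta> < pi \<and> \<theta> \<noteq> pi / 2 \<longrightarrow>
         (\<exists>\<phi>1 \<phi>2. 0 \<le> \<phi>2 \<and> \<phi>2 \<le> pi \<and> \<phi>1 + \<phi>2 = \<theta> \<and>
            m1 * sin (2 * \<phi>1) = m2 * sin (2 * \<phi>2) \<and>
            velocity_relation m1 m2 f \<theta> \<phi>1 \<phi>2 (norm \<xi>) (norm \<eta>) \<and>
            conjugate x (standard_motion m1 m2 (norm \<xi>) (norm \<eta>) (expi (- \<phi>1)) (expi \<phi>2)))) \<and>
       (\<theta> = pi / 2 \<longrightarrow>
         m1 = m2 \<and>
         (\<exists>\<phi>1 \<phi>2. \<phi>1 + \<phi>2 = pi / 2 \<and> right_angle_range \<Theta> f \<phi>1 \<and>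
            velocity_relation m1 m2 f \<theta> \<phi>1 \<phi>2 (norm \<xi>) (norm \<eta>) \<and>
            conjugate x (standard_motion m1 m2 (norm \<xi>) (norm \<eta>) (expi (- \<phi>1)) (expi \<phi>2)))))
     \<and> \<comment> \<open>everything in the list is a relative equilibrium with the stated angle and generator\<close>
     (\<forall>a\<ge>0. \<forall>b\<ge>0.
       (0 \<in> \<Theta> \<longrightarrow>
         relative_equilibrium \<Theta> m1 m2 V (a *\<^sub>R qj) (b *\<^sub>R qj) (standard_motion m1 m2 a b 1 1) \<and>
         phase_angle (standard_motion m1 m2 a b 1 1 0) = 0) \<and>
       (pi \<in> \<Theta> \<longrightarrow>
         relative_equilibrium \<Theta> m1 m2 V (a *\<^sub>R qj) (b *\<^sub>R qj) (standard_motion m1 m2 a b 1 (- 1)) \<and>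
         phase_angle (standard_motion m1 m2 a b 1 (- 1) 0) = pi) \<and>
       (\<forall>\<theta> \<phi>1 \<phi>2.
         (0 < \<theta> \<and> \<theta> < pi \<and> \<theta> \<noteq> pi / 2 \<and> \<phi>1 + \<phi>2 = \<theta> \<and> m1 * sin (2 * \<phi>1) = m2 * sin (2 * \<phi>2) \<or>
          \<theta> = pi / 2 \<and> m1 = m2 \<and> \<phi>1 + \<phi>2 = pi / 2 \<and> right_angle_range \<Theta> f \<phi>1) \<and>
         velocity_relation m1 m2 f \<theta> \<phi>1 \<phi>2 a b \<longrightarrow>
         relative_equilibrium \<Theta> m1 m2 V (a *\<^sub>R qj) (b *\<^sub>R qj)
           (standard_motion m1 m2 a b (expi (- \<phi>1)) (expi \<phi>2)) \<and>
         phase_angle (standard_motion m1 m2 a b (expi (- \<phi>1)) (expi \<phi>2) 0) = \<theta>))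
     \<and> \<comment> \<open>in the acute and obtuse cases \<open>\<theta>\<close> determines the two angles\<close>
     (\<forall>\<theta>. 0 < \<theta> \<and> \<theta> < pi \<and> \<theta> \<noteq> pi / 2 \<longrightarrow>
       (\<exists>!(\<phi>1, \<phi>2). 0 \<le> \<phi>2 \<and> \<phi>2 \<le> pi \<and> \<phi>1 + \<phi>2 = \<theta> \<and>
          m1 * sin (2 * \<phi>1) = m2 * sin (2 * \<phi>2) \<and>
          (\<exists>a\<ge>0. \<exists>b\<ge>0. velocity_relation m1 m2 f \<theta> \<phi>1 \<phi>2 a b)))
     \<and> \<comment> \<open>in the right-angled case every angle in the stated range occurs\<close>
     (m1 = m2 \<longrightarrow>
       (\<forall>\<phi>1 \<phi>2. \<phi>1 + \<phi>2 = pi / 2 \<and> right_angle_range \<Theta> f \<phi>1 \<longrightarrow>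
          (\<exists>a\<ge>0. \<exists>b\<ge>0. velocity_relation m1 m2 f (pi / 2) \<phi>1 \<phi>2 a b)))
     \<and> \<comment> \<open>distinct non-singular members of the list are not conjugate\<close>
     (\<forall>a\<ge>0. \<forall>b\<ge>0. \<forall>a'\<ge>0. \<forall>b'\<ge>0. \<forall>\<phi>1 \<phi>2 \<phi>1' \<phi>2'.
       0 \<le> \<phi>2 \<and> \<phi>2 \<le> pi \<and> 0 < \<phi>1 + \<phi>2 \<and> \<phi>1 + \<phi>2 < pi \<and>
       0 \<le> \<phi>2' \<and> \<phi>2' \<le> pi \<and> 0 < \<phi>1' + \<phi>2' \<and> \<phi>1' + \<phi>2' < pi \<and>
       relative_equilibrium \<Theta> m1 m2 V (a *\<^sub>R qj) (b *\<^sub>R qj)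
         (standard_motion m1 m2 a b (expi (- \<phi>1)) (expi \<phi>2)) \<and>
       relative_equilibrium \<Theta> m1 m2 V (a' *\<^sub>R qj) (b' *\<^sub>R qj)
         (standard_motion m1 m2 a' b' (expi (- \<phi>1')) (expi \<phi>2')) \<and>
       conjugate (standard_motion m1 m2 a b (expi (- \<phi>1)) (expi \<phi>2))
         (standard_motion m1 m2 a' b' (expi (- \<phi>1')) (expi \<phi>2')) \<longrightarrow>
       a = a' \<and> b = b' \<and> \<phi>1 = \<phi>1' \<and> \<phi>2 = \<phi>2')"
proof -
  interpret two_body m1 m2 \<Theta> V f
    using assms by unfold_locales
  have f_nz: "f \<theta> \<noteq> 0" if "0 < \<theta>" "\<theta> < pi" for \<theta>
  proof -
    have "\<theta> \<in> \<Theta>" using that angles by auto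
    then show ?thesis
      using assms(7) by (auto simp: strictly_attractive_def strictly_repulsive_def)
  qed
  have sin_pos: "0 < sin \<theta>" if "0 < \<theta>" "\<theta> < pi" for \<theta> :: real
    using that by (rule sin_gt_zero)
  have velocities: "m1 * sin (2 * \<phi>1) = m2 * sin (2 * \<phi>2)" "0 < f \<theta> * sin (2 * \<phi>2)"
    if "velocity_relation m1 m2 f \<theta> \<phi>1 \<phi>2 a b" "0 \<le> a" "0 \<le> b" "0 < \<theta>" "\<theta> < pi" for \<theta> \<phi>1 \<phi>2 a b
    using exists_velocities_iff [of m2 \<theta> f m1 \<phi>1 \<phi>2, OF masses(2) sin_pos f_nz] that by blast+
  have right_angle: "sin (2 * \<phi>1) = sin (2 * \<phi>2)" if "\<phi>1 + \<phi>2 = pi / 2" for \<phi>1 \<phi>2 :: real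
  proof -
    have "2 * \<phi>1 = pi - 2 * \<phi>2" using that by simp
    then show ?thesis by simp
  qed
  have right_in: "pi / 2 \<in> \<Theta>" using angles by auto
  show ?thesis
  proof (intro conjI)
    show "\<forall>\<xi> \<eta> x \<theta>. relative_equilibrium \<Theta> m1 m2 V \<xi> \<eta> x \<and> \<theta> = phase_angle (x 0) \<longrightarrow>
       (\<theta> = 0 \<longrightarrow>
         (\<exists>a\<ge>0. \<exists>b\<ge>0. conjugate x (standard_motion m1 m2 a b 1 1))) \<and>
       (\<theta> = pi \<longrightarrow>
         (\<exists>a\<ge>0. \<exists>b\<ge>0. conjugate x (standard_motion m1 m2 a b 1 (- 1)))) \<and>
       (0 < \<theta> \<and> \<theta> < pi \<and> \<theta> \<noteq> pi / 2 \<longrightarrow>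
         (\<exists>\<phi>1 \<phi>2. 0 \<le> \<phi>2 \<and> \<phi>2 \<le> pi \<and> \<phi>1 + \<phi>2 = \<theta> \<and>
            m1 * sin (2 * \<phi>1) = m2 * sin (2 * \<phi>2) \<and>
            velocity_relation m1 m2 f \<theta> \<phi>1 \<phi>2 (norm \<xi>) (norm \<eta>) \<and>
            conjugate x (standard_motion m1 m2 (norm \<xi>) (norm \<eta>) (expi (- \<phi>1)) (expi \<phi>2)))) \<and>
       (\<theta> = pi / 2 \<longrightarrow>
         m1 = m2 \<and>
         (\<exists>\<phi>1 \<phi>2. \<phi>1 + \<phi>2 = pi / 2 \<and> right_angle_range \<Theta> f \<phi>1 \<and>
            velocity_relation m1 m2 f \<theta> \<phi>1 \<phi>2 (norm \<xi>) (norm \<eta>) \<and>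
            conjugate x (standard_motion m1 m2 (norm \<xi>) (norm \<eta>) (expi (- \<phi>1)) (expi \<phi>2))))"
      (is "\<forall>\<xi> \<eta> x \<theta>. _ \<longrightarrow> ?zero x \<theta> \<and> ?pi x \<theta> \<and> ?generic \<xi> \<eta> x \<theta> \<and> ?right \<xi> \<eta> x \<theta>")
    proof (intro allI impI)
      fix \<xi> \<eta> x \<theta>
      assume "relative_equilibrium \<Theta> m1 m2 V \<xi> \<eta> x \<and> \<theta> = phase_angle (x 0)"
      then have re: "relative_equilibrium \<Theta> m1 m2 V \<xi> \<eta> x" and \<theta>: "\<theta> = phase_angle (x 0)" by auto
      obtain g1 p1 g2 p2 where x0: "x 0 = (g1, p1, g2, p2)" using prod_cases4 by blast
      have "x 0 \<in> phase_space \<Theta>"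
        using re unfolding relative_equilibrium_def hamiltonian_solution_def by blast
      then have g: "g1 \<in> S3" "g2 \<in> S3" by (simp_all add: x0 phase_space_def)
      have cos\<theta>: "g1 \<bullet> g2 = cos \<theta>"
        using cos_subtended_angle [OF g] by (simp add: \<theta> x0 phase_angle_def)
      note nonsingular = nonsingular_classification [OF re \<theta>]
      have zero: "?zero x \<theta>"
      proof
        assume "\<theta> = 0"
        then have "g2 = 1 * g1" using cos\<theta> S3_inner_eq_1_iff [OF g] by simp
        with singular_classification [OF re, of g1 p1 1 p2] x0
        show "\<exists>a\<ge>0. \<exists>b\<ge>0. conjugate x (standard_motion m1 m2 a b 1 1)" by blast
      qed
      moreover have "?pi x \<theta>"
      proof
        assume "\<theta> = pi"
        then have "g2 = - 1 * g1" using cos\<theta> S3_inner_eq_minus_1_iff [OF g] by simp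
        with singular_classification [OF re, of g1 p1 "- 1" p2] x0
        show "\<exists>a\<ge>0. \<exists>b\<ge>0. conjugate x (standard_motion m1 m2 a b 1 (- 1))" by blast
      qed
      moreover have "?generic \<xi> \<eta> x \<theta>"
      proof
        assume range: "0 < \<theta> \<and> \<theta> < pi \<and> \<theta> \<noteq> pi / 2"
        then obtain \<phi>1 \<phi>2 where *: "\<phi>1 + \<phi>2 = \<theta>" "0 \<le> \<phi>2" "\<phi>2 < pi"
          "velocity_relation m1 m2 f \<theta> \<phi>1 \<phi>2 (norm \<xi>) (norm \<eta>)"
          "conjugate x (standard_motion m1 m2 (norm \<xi>) (norm \<eta>) (expi (- \<phi>1)) (expi \<phi>2))"
          using nonsingular f_nz by blast
        have "m1 * sin (2 * \<phi>1) = m2 * sin (2 * \<phi>2)"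
          using velocities(1) [OF *(4)] range by simp
        with * show "\<exists>\<phi>1 \<phi>2. 0 \<le> \<phi>2 \<and> \<phi>2 \<le> pi \<and> \<phi>1 + \<phi>2 = \<theta> \<and>
            m1 * sin (2 * \<phi>1) = m2 * sin (2 * \<phi>2) \<and>
            velocity_relation m1 m2 f \<theta> \<phi>1 \<phi>2 (norm \<xi>) (norm \<eta>) \<and>
            conjugate x (standard_motion m1 m2 (norm \<xi>) (norm \<eta>) (expi (- \<phi>1)) (expi \<phi>2))"
          using less_imp_le by blast
      qed
      moreover have "?right \<xi> \<eta> x \<theta>"
      proof
        assume right: "\<theta> = pi / 2"
        then have range: "0 < \<theta>" "\<theta> < pi" using pi_gt_zero by linarith+
        then obtain \<phi>1 \<phi>2 where *: "\<phi>1 + \<phi>2 = \<theta>" "0 \<le> \<phi>2" "\<phi>2 < pi"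
          "velocity_relation m1 m2 f \<theta> \<phi>1 \<phi>2 (norm \<xi>) (norm \<eta>)"
          "conjugate x (standard_motion m1 m2 (norm \<xi>) (norm \<eta>) (expi (- \<phi>1)) (expi \<phi>2))"
          using nonsingular f_nz by blast
        have \<zeta>: "m1 * sin (2 * \<phi>1) = m2 * sin (2 * \<phi>2)" "0 < f \<theta> * sin (2 * \<phi>2)"
          using velocities [OF *(4)] range by simp_all
        have \<phi>1: "\<phi>1 = pi / 2 - \<phi>2" using * right by simp
        \<comment> \<open>The two sines agree at a right angle and are nonzero by the sign
          condition, so they cancel.\<close>
        have "m1 = m2" using \<zeta> right_angle [of \<phi>1 \<phi>2] \<phi>1 by auto
        moreover have "right_angle_range \<Theta> f \<phi>1"
          unfolding right_angle_range_def
        proof (intro conjI impI)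
          assume "strictly_attractive \<Theta> f"
          then have "0 < f \<theta>" using right_in unfolding right by (simp add: strictly_attractive_def)
          \<comment> \<open>As \<open>\<phi>2\<close> lies in \<open>[0, pi)\<close>, a positive
            sine leaves only \<open>0 < \<phi>2 < pi / 2\<close>.\<close>
          with \<zeta> have "0 < sin (2 * \<phi>2)" by (simp add: zero_less_mult_iff)
          moreover have "sin (2 * \<phi>2) \<le> 0" if "pi / 2 \<le> \<phi>2"
            using sin_le_zero [of "2 * \<phi>2"] that * by simp
          moreover have "\<phi>2 \<noteq> 0" using \<zeta> by auto
          ultimately show "0 < \<phi>1" "\<phi>1 < pi / 2" using * unfolding \<phi>1 by fastforce+
        next
          assume "strictly_repulsive \<Theta> f"
          then have "f \<theta> < 0" using right_in unfolding right by (simp add: strictly_repulsive_def)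
          \<comment> \<open>A negative sine leaves only
            \<open>pi / 2 < \<phi>2 < pi\<close>.\<close>
          with \<zeta> have "sin (2 * \<phi>2) < 0" by (simp add: zero_less_mult_iff)
          moreover have "0 \<le> sin (2 * \<phi>2)" if "\<phi>2 \<le> pi / 2"
            using sin_ge_zero [of "2 * \<phi>2"] that * by simp
          ultimately show "- pi / 2 < \<phi>1" "\<phi>1 < 0" using * unfolding \<phi>1 by fastforce+
        qed
        ultimately show "m1 = m2 \<and>
         (\<exists>\<phi>1 \<phi>2. \<phi>1 + \<phi>2 = pi / 2 \<and> right_angle_range \<Theta> f \<phi>1 \<and>
            velocity_relation m1 m2 f \<theta> \<phi>1 \<phi>2 (norm \<xi>) (norm \<eta>) \<and>
            conjugate x (standard_motion m1 m2 (norm \<xi>) (norm \<eta>) (expi (- \<phi>1)) (expi \<phi>2)))"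
          using * unfolding right by blast
      qed
      ultimately show "?zero x \<theta> \<and> ?pi x \<theta> \<and> ?generic \<xi> \<eta> x \<theta> \<and> ?right \<xi> \<eta> x \<theta>" by (intro conjI)
    qed
  next
    have listed: "relative_equilibrium \<Theta> m1 m2 V (a *\<^sub>R qj) (b *\<^sub>R qj) (standard_motion m1 m2 a b (expi (- \<phi>1)) (expi \<phi>2)) \<and>
        phase_angle (standard_motion m1 m2 a b (expi (- \<phi>1)) (expi \<phi>2) 0) = \<theta>"
      if "(0 < \<theta> \<and> \<theta> < pi \<and> \<theta> \<noteq> pi / 2 \<and> \<phi>1 + \<phi>2 = \<theta> \<and> m1 * sin (2 * \<phi>1) = m2 * sin (2 * \<phi>2) \<or>
          \<theta> = pi / 2 \<and> m1 = m2 \<and> \<phi>1 + \<phi>2 = pi / 2 \<and> right_angle_range \<Theta> f \<phi>1) \<and>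
         velocity_relation m1 m2 f \<theta> \<phi>1 \<phi>2 a b" for a b \<theta> \<phi>1 \<phi>2
    proof -
      have "0 < \<theta>" "\<theta> < pi" "\<phi>1 + \<phi>2 = \<theta>"
        using that pi_gt_zero by linarith+
      with that show ?thesis
        using relative_equilibrium_expi_iff [of \<phi>1 \<phi>2 a b] subtended_angle_expi [of \<phi>1 \<phi>2] f_nz
        by (simp add: standard_motion_0 phase_angle_def)
    qed
    have angle_pm1: "subtended_angle 1 1 = 0" "subtended_angle 1 (- 1) = pi"
      using S3_inner_self [of 1] by (simp_all add: subtended_angle_def)
    then have zero: "relative_equilibrium \<Theta> m1 m2 V (a *\<^sub>R qj) (b *\<^sub>R qj) (standard_motion m1 m2 a b 1 1) \<and>
         phase_angle (standard_motion m1 m2 a b 1 1 0) = 0" if "0 \<in> \<Theta>" for a b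
      using that relative_equilibrium_pm1 by (simp add: standard_motion_0 phase_angle_def)
    have antipodal: "relative_equilibrium \<Theta> m1 m2 V (a *\<^sub>R qj) (b *\<^sub>R qj) (standard_motion m1 m2 a b 1 (- 1)) \<and>
         phase_angle (standard_motion m1 m2 a b 1 (- 1) 0) = pi" if "pi \<in> \<Theta>" for a b
      using that relative_equilibrium_pm1 angle_pm1 by (simp add: standard_motion_0 phase_angle_def)
    show "\<forall>a\<ge>0. \<forall>b\<ge>0.
       (0 \<in> \<Theta> \<longrightarrow>
         relative_equilibrium \<Theta> m1 m2 V (a *\<^sub>R qj) (b *\<^sub>R qj) (standard_motion m1 m2 a b 1 1) \<and>
         phase_angle (standard_motion m1 m2 a b 1 1 0) = 0) \<and>
       (pi \<in> \<Theta> \<longrightarrow>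
         relative_equilibrium \<Theta> m1 m2 V (a *\<^sub>R qj) (b *\<^sub>R qj) (standard_motion m1 m2 a b 1 (- 1)) \<and>
         phase_angle (standard_motion m1 m2 a b 1 (- 1) 0) = pi) \<and>
       (\<forall>\<theta> \<phi>1 \<phi>2.
         (0 < \<theta> \<and> \<theta> < pi \<and> \<theta> \<noteq> pi / 2 \<and> \<phi>1 + \<phi>2 = \<theta> \<and> m1 * sin (2 * \<phi>1) = m2 * sin (2 * \<phi>2) \<or>
          \<theta> = pi / 2 \<and> m1 = m2 \<and> \<phi>1 + \<phi>2 = pi / 2 \<and> right_angle_range \<Theta> f \<phi>1) \<and>
         velocity_relation m1 m2 f \<theta> \<phi>1 \<phi>2 a b \<longrightarrow>
         relative_equilibrium \<Theta> m1 m2 V (a *\<^sub>R qj) (b *\<^sub>R qj)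
           (standard_motion m1 m2 a b (expi (- \<phi>1)) (expi \<phi>2)) \<and>
         phase_angle (standard_motion m1 m2 a b (expi (- \<phi>1)) (expi \<phi>2) 0) = \<theta>)"
      using zero antipodal listed by blast
  next
    show "\<forall>\<theta>. 0 < \<theta> \<and> \<theta> < pi \<and> \<theta> \<noteq> pi / 2 \<longrightarrow>
       (\<exists>!(\<phi>1, \<phi>2). 0 \<le> \<phi>2 \<and> \<phi>2 \<le> pi \<and> \<phi>1 + \<phi>2 = \<theta> \<and>
          m1 * sin (2 * \<phi>1) = m2 * sin (2 * \<phi>2) \<and>
          (\<exists>a\<ge>0. \<exists>b\<ge>0. velocity_relation m1 m2 f \<theta> \<phi>1 \<phi>2 a b))"
    proof (intro allI impI)
      fix \<theta> :: real
      assume \<theta>: "0 < \<theta> \<and> \<theta> < pi \<and> \<theta> \<noteq> pi / 2"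
      note velocities_iff = exists_velocities_iff [of m2 \<theta> f m1, OF masses(2) sin_pos f_nz]
      let ?P = "\<lambda>\<phi>2. 0 \<le> \<phi>2 \<and> \<phi>2 \<le> pi \<and> m1 * sin (2 * (\<theta> - \<phi>2)) = m2 * sin (2 * \<phi>2) \<and> 0 < f \<theta> * sin (2 * \<phi>2)"
      obtain \<phi> where \<phi>: "?P \<phi>" and unique: "\<And>\<phi>'. ?P \<phi>' \<Longrightarrow> \<phi>' = \<phi>"
        using acute_obtuse_angles_unique [of m1 \<theta> "f \<theta>" m2] masses \<theta> f_nz by blast
      show "\<exists>!(\<phi>1, \<phi>2). 0 \<le> \<phi>2 \<and> \<phi>2 \<le> pi \<and> \<phi>1 + \<phi>2 = \<theta> \<and>
          m1 * sin (2 * \<phi>1) = m2 * sin (2 * \<phi>2) \<and>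
          (\<exists>a\<ge>0. \<exists>b\<ge>0. velocity_relation m1 m2 f \<theta> \<phi>1 \<phi>2 a b)"
      \<comment> \<open>The first angle is \<open>\<theta> - \<phi>2\<close>, so uniqueness of the
        pair is uniqueness of \<open>\<phi>2\<close>; the sign condition in \<open>?P\<close>
        expresses that suitable velocities exist.\<close>
      proof (rule ex1I [of _ "(\<theta> - \<phi>, \<phi>)"])
        fix \<psi>
        assume *: "case \<psi> of (\<phi>1, \<phi>2) \<Rightarrow> 0 \<le> \<phi>2 \<and> \<phi>2 \<le> pi \<and> \<phi>1 + \<phi>2 = \<theta> \<and>
          m1 * sin (2 * \<phi>1) = m2 * sin (2 * \<phi>2) \<and>
          (\<exists>a\<ge>0. \<exists>b\<ge>0. velocity_relation m1 m2 f \<theta> \<phi>1 \<phi>2 a b)"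
        obtain \<phi>1 \<phi>2 where \<psi>: "\<psi> = (\<phi>1, \<phi>2)" by (rule prod.exhaust)
        with * have "\<phi>1 = \<theta> - \<phi>2" by auto
        moreover from * \<psi> this have "?P \<phi>2" using velocities_iff \<theta> by auto
        ultimately show "\<psi> = (\<theta> - \<phi>, \<phi>)" using unique \<psi> by blast
      qed (use \<phi> velocities_iff \<theta> in auto)
    qed
  next
    show "m1 = m2 \<longrightarrow>
       (\<forall>\<phi>1 \<phi>2. \<phi>1 + \<phi>2 = pi / 2 \<and> right_angle_range \<Theta> f \<phi>1 \<longrightarrow>
          (\<exists>a\<ge>0. \<exists>b\<ge>0. velocity_relation m1 m2 f (pi / 2) \<phi>1 \<phi>2 a b))"
    proof (intro allI impI)
      fix \<phi>1 \<phi>2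
      assume m: "m1 = m2" and *: "\<phi>1 + \<phi>2 = pi / 2 \<and> right_angle_range \<Theta> f \<phi>1"
      then have eq: "sin (2 * \<phi>1) = sin (2 * \<phi>2)" by (simp add: right_angle)
      have "0 < f (pi / 2) * sin (2 * \<phi>1)"
        using assms(7)
      proof
        assume att: "strictly_attractive \<Theta> f"
        with * have "0 < sin (2 * \<phi>1)" by (auto simp: right_angle_range_def intro!: sin_gt_zero)
        with att right_in show ?thesis by (simp add: strictly_attractive_def)
      next
        assume rep: "strictly_repulsive \<Theta> f"
        with * have "0 < sin (2 * - \<phi>1)" by (intro sin_gt_zero) (auto simp: right_angle_range_def)
        with rep right_in show ?thesis by (simp add: strictly_repulsive_def mult_neg_neg)
      qed
      then show "\<exists>a\<ge>0. \<exists>b\<ge>0. velocity_relation m1 m2 f (pi / 2) \<phi>1 \<phi>2 a b"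
        using exists_velocities_iff [of m2 "pi / 2" f m1 \<phi>1 \<phi>2] masses f_nz m eq by simp
    qed
  next
    have unique: "a = a' \<and> b = b' \<and> \<phi>1 = \<phi>1' \<and> \<phi>2 = \<phi>2'"
      if nonneg: "0 \<le> a" "0 \<le> b" "0 \<le> a'" "0 \<le> b'"
        and \<phi>: "0 \<le> \<phi>2" "\<phi>2 \<le> pi" "0 < \<phi>1 + \<phi>2" "\<phi>1 + \<phi>2 < pi"
        and \<phi>': "0 \<le> \<phi>2'" "\<phi>2' \<le> pi" "0 < \<phi>1' + \<phi>2'" "\<phi>1' + \<phi>2' < pi"
        and re: "relative_equilibrium \<Theta> m1 m2 V (a *\<^sub>R qj) (b *\<^sub>R qj)
         (standard_motion m1 m2 a b (expi (- \<phi>1)) (expi \<phi>2))"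
        and re': "relative_equilibrium \<Theta> m1 m2 V (a' *\<^sub>R qj) (b' *\<^sub>R qj)
         (standard_motion m1 m2 a' b' (expi (- \<phi>1')) (expi \<phi>2'))"
        and conj: "conjugate (standard_motion m1 m2 a b (expi (- \<phi>1)) (expi \<phi>2))
         (standard_motion m1 m2 a' b' (expi (- \<phi>1')) (expi \<phi>2'))"
      for a b a' b' \<phi>1 \<phi>2 \<phi>1' \<phi>2'
    proof -
      \<comment> \<open>The velocity relation has a nonzero right-hand side, which excludes zero
        velocities, and its nonzero \<open>\<zeta>\<close> excludes the endpoints for
        \<open>\<phi>2\<close>.\<close>
      have strict: "0 < a \<and> 0 < b \<and> 0 < \<phi>2 \<and> \<phi>2 < pi"
        if "0 \<le> a" "0 \<le> b" and \<phi>: "0 \<le> \<phi>2" "\<phi>2 \<le> pi" "0 < \<phi>1 + \<phi>2" "\<phi>1 + \<phi>2 < pi"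
          and "relative_equilibrium \<Theta> m1 m2 V (a *\<^sub>R qj) (b *\<^sub>R qj)
            (standard_motion m1 m2 a b (expi (- \<phi>1)) (expi \<phi>2))" for a b \<phi>1 \<phi>2
      proof -
        have vel: "velocity_relation m1 m2 f (\<phi>1 + \<phi>2) \<phi>1 \<phi>2 a b"
          using that relative_equilibrium_expi_iff f_nz by blast
        have "f (\<phi>1 + \<phi>2) * sin (\<phi>1 + \<phi>2) \<noteq> 0"
          using f_nz sin_pos \<phi>(3,4) by (simp add: less_imp_neq [THEN not_sym])
        with vel have "a \<noteq> 0" "b \<noteq> 0"
          by (auto simp: velocity_relation_def)
        moreover have "sin (2 * \<phi>2) \<noteq> 0"
          using vel by (auto simp: velocity_relation_def)
        then have "\<phi>2 \<noteq> 0" "\<phi>2 \<noteq> pi" by auto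
        ultimately show ?thesis using that by simp
      qed
      from strict [OF nonneg(1,2) \<phi> re] strict [OF nonneg(3,4) \<phi>' re'] show ?thesis
        using conjugate_standard_motion_unique [OF masses _ _ _ _ _ _ \<phi>(3,4) _ _ \<phi>'(3,4) conj] by blast
    qed
    then show "\<forall>a\<ge>0. \<forall>b\<ge>0. \<forall>a'\<ge>0. \<forall>b'\<ge>0. \<forall>\<phi>1 \<phi>2 \<phi>1' \<phi>2'.
       0 \<le> \<phi>2 \<and> \<phi>2 \<le> pi \<and> 0 < \<phi>1 + \<phi>2 \<and> \<phi>1 + \<phi>2 < pi \<and>
       0 \<le> \<phi>2' \<and> \<phi>2' \<le> pi \<and> 0 < \<phi>1' + \<phi>2' \<and> \<phi>1' + \<phi>2' < pi \<and>
       relative_equilibrium \<Theta> m1 m2 V (a *\<^sub>R qj) (b *\<^sub>R qj)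
         (standard_motion m1 m2 a b (expi (- \<phi>1)) (expi \<phi>2)) \<and>
       relative_equilibrium \<Theta> m1 m2 V (a' *\<^sub>R qj) (b' *\<^sub>R qj)
         (standard_motion m1 m2 a' b' (expi (- \<phi>1')) (expi \<phi>2')) \<and>
       conjugate (standard_motion m1 m2 a b (expi (- \<phi>1)) (expi \<phi>2))
         (standard_motion m1 m2 a' b' (expi (- \<phi>1')) (expi \<phi>2')) \<longrightarrow>
       a = a' \<and> b = b' \<and> \<phi>1 = \<phi>1' \<and> \<phi>2 = \<phi>2'"
      by (intro allI impI) (elim conjE, rule unique)
  qed
qed

end
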